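(* Fix $A,B,C>0$, $p,q>1$ and $r,s>0$. Let $\{e_n\}_{n=1}^{\infty}\subset L^2(\mathbb{R})$ with $\|e_n\|_2=1$ for all $n$ satisfy $$\forall f\in L^2(\mathbb{R}),\quad B\left(\sum_{n=1}^{\infty}|\langle f,e_n\rangle|^s\right)^{1/s}\leq \|f\|_2\leq C\left(\sum_{n=1}^{\infty}|\langle f,e_n\rangle|^r\right)^{1/r}.$$ If $qr>2$, then it is not possible for $\{e_n\}_{n=1}^{\infty}$ to satisfy $$\forall n\in\mathbb{N},\quad |\mu_p(e_n)|\leq A,\quad |\Delta_p(e_n)|\leq A,\quad\text{and}\quad |\Delta_q(\widehat{e_n})|\leq A.$$
   Context: The Fourier transform on $L^2(\mathbb{R})$ is normalized by $\widehat{f}(\xi)=\int f(t)e^{-2\pi i t\xi}\,dt$. For $p>1$ and $h\in L^2(\mathbb{R})$ with $\|h\|_2=1$, the $p$-dispersion of $h$ is $\Delta_p(h)=\min_{a\in\mathbb{R}}\left(\int|t-a|^p|h(t)|^2\,dt\right)^{1/2}$ (equal to $\infty$ if $\int|t|^p|h(t)|^2\,dt=\infty$). When $\Delta_p(h)$ is finite, the $p$-mean $\mu_p(h)$ is the unique $a\in\mathbb{R}$ attaining this minimum (uniqueness holds by strict convexity since $p>1$). A bound such as $|\mu_p(h)|\le A$ or $\Delta_p(h)\le A$ includes the requirement that the quantity be defined and finite. *)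

theory Defs
  imports "HOL-Analysis.Analysis"
begin

(* Elements of L^2(R) are represented by Borel functions; every class of almost everywhere equal
   Lebesgue measurable functions has a Borel representative, and no notion below
   depends on the choice of representative. *)
definition L2 :: "(real \<Rightarrow> complex) set" where
  "L2 = {f. f \<in> borel_measurable lborel \<and> integrable lborel (\<lambda>t. (cmod (f t))\<^sup>2)}"

definition L2_norm :: "(real \<Rightarrow> complex) \<Rightarrow> real" where
  "L2_norm f = sqrt (LINT t|lborel. (cmod (f t))\<^sup>2)"

definition L2_inner :: "(real \<Rightarrow> complex) \<Rightarrow> (real \<Rightarrow> complex) \<Rightarrow> complex" where
  "L2_inner f g = (LINT t|lborel. f t * cnj (g t))"

definition fourier_integral :: "(real \<Rightarrow> complex) \<Rightarrow> real \<Rightarrow> complex" where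
  "fourier_integral f \<xi> = (LINT t|lborel. f t * exp (- 2 * of_real pi * \<i> * of_real t * of_real \<xi>))"

(* The Fourier transform on L^2 is the L^2-limit of the Fourier integrals of the truncations of f
   to [-N, N], which lie in both L^1 and L^2. The squared L^2-distance is a nonnegative
   (possibly infinite) integral, because a Bochner integral would be 0 for a non-integrable
   integrand. *)
definition is_L2_fourier :: "(real \<Rightarrow> complex) \<Rightarrow> (real \<Rightarrow> complex) \<Rightarrow> bool" where
  "is_L2_fourier f g \<longleftrightarrow> g \<in> L2 \<and>
     (\<lambda>N::nat. \<integral>\<^sup>+\<xi>. ennreal ((cmod
        (fourier_integral (\<lambda>t. indicator {- real N..real N} t * f t) \<xi> - g \<xi>))\<^sup>2) \<partial>lborel)
       \<longlonglongrightarrow> 0"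

(* Such a limit exists for every f in L^2 (Plancherel) and is unique almost everywhere;
   the choice operator only selects a representative. *)
definition L2_fourier :: "(real \<Rightarrow> complex) \<Rightarrow> real \<Rightarrow> complex" where
  "L2_fourier f = (SOME g. is_L2_fourier f g)"

(* Real powers on [0, \<infinity>], used only with exponent a > 0. *)
definition ennpowr :: "ennreal \<Rightarrow> real \<Rightarrow> ennreal" where
  "ennpowr x a = (if x = \<infinity> then \<infinity> else ennreal (enn2real x powr a))"

definition lp_size :: "real \<Rightarrow> (nat \<Rightarrow> complex) \<Rightarrow> ennreal" where
  "lp_size r c = ennpowr (\<Sum>n. ennreal (cmod (c n) powr r)) (1 / r)"

definition spread :: "real \<Rightarrow> (real \<Rightarrow> complex) \<Rightarrow> real \<Rightarrow> ennreal" where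
  "spread p h a = ennpowr (\<integral>\<^sup>+t. ennreal (\<bar>t - a\<bar> powr p * (cmod (h t))\<^sup>2) \<partial>lborel) (1 / 2)"

(* The infimum is attained (for p > 1 and h in L^2) and is \<infinity> if the p-th moment is infinite. *)
definition dispersion :: "real \<Rightarrow> (real \<Rightarrow> complex) \<Rightarrow> ennreal" where
  "dispersion p h = (INF a. spread p h a)"

(* Meaningful only if dispersion p h < \<infinity>, where the minimizer is unique for p > 1
   and h of norm 1. *)
definition p_mean :: "real \<Rightarrow> (real \<Rightarrow> complex) \<Rightarrow> real" where
  "p_mean p h = (THE a. spread p h a = dispersion p h)"

end

theory Submission
  imports Defs "HOL-Probability.Probability"
begin

text \<open>
  Suppose that the \<open>e n\<close> are uniformly localized around a bounded set of times, and around
  frequencies \<open>b n\<close> with uniformly bounded dispersion. The contradiction comes from testing the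
  \<open>r\<close>-inequality on Gaussians that escape to infinity in time.

  The first point is that the frequency centres cannot accumulate: the number of \<open>n\<close> with
  \<open>\<bar>b n - k\<bar> \<le> 1\<close> is bounded uniformly in \<open>k\<close> (\<open>bounded_occupancy\<close>). Functions that are localized in time near 0
  and in frequency near \<open>k\<close> form, up to modulation by \<open>k\<close>, a relatively compact family. Concretely,
  each of them has an inner product bounded below with one of finitely many indicator functions of short intervals,
  modulated to frequency \<open>k\<close> (\<open>cell_detection\<close>). By the \<open>s\<close>-inequality, a single test function of
  bounded norm can have only boundedly many coefficients above a fixed threshold.

  The second point is decay. The transform of a translated Gaussian has Gaussian modulus, whatever the translation, so
  the bound on the \<open>q\<close>-dispersion shows that its coefficient with \<open>e n\<close> is at most a
  constant times \<open>(1 + \<bar>b n\<bar>)\<close> to the power \<open>- q / 2\<close> (\<open>gauss_pairing_decay\<close>). The \<open>r\<close>-th powers of these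
  bounds are summable because \<open>q r / 2 > 1\<close> and the \<open>b n\<close> have bounded density. For each fixed \<open>n\<close> the coefficient
  tends to 0 as the Gaussian moves to infinity. By Tannery's theorem the \<open>r\<close>-sum of
  the coefficients tends to 0, while the norm of the Gaussian stays constant and positive. This contradicts
  the \<open>r\<close>-inequality.

  Two foundations support this. The Fourier transform is treated on all of \<open>L\<^sup>2\<close>: its existence
  (\<open>L2_fourier_exists\<close>) rests on the inequality \<open>Bessel_fourier_integral\<close> for integrable functions, and the
  low-pass approximation needed for the first point (\<open>bandlimited_approximation\<close>) rests on inversion. The
  localization in time is stated through the \<open>p\<close>-mean, which has to be shown to be the unique
  minimizer of the spread (\<open>spread_p_mean\<close>).
\<close>

section \<open>Square-integrable functions\<close>

text \<open>
  The squared \<open>L\<^sup>2\<close> norm with values in \<open>[0, \<infinity>]\<close>, so that comparisons, limits and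
  Fatou's lemma apply before square integrability is known. The
  triangle inequality is replaced by a quasi-triangle inequality with factor 2, since all estimates
  below have room for absolute constants.
\<close>

definition energy :: "(real \<Rightarrow> complex) \<Rightarrow> ennreal" where
  "energy f = (\<integral>\<^sup>+t. ennreal ((cmod (f t))\<^sup>2) \<partial>lborel)"

lemma L2_iff_energy: "f \<in> L2 \<longleftrightarrow> f \<in> borel_measurable borel \<and> energy f < \<infinity>"
  unfolding L2_def energy_def by (auto simp: integrable_iff_bounded)

lemma energy_eq_integral: "f \<in> L2 \<Longrightarrow> energy f = ennreal (LINT t|lborel. (cmod (f t))\<^sup>2)"
  unfolding energy_def by (intro nn_integral_eq_integral) (auto simp: L2_def)

lemma energy_eq_L2_norm: "f \<in> L2 \<Longrightarrow> energy f = ennreal ((L2_norm f)\<^sup>2)"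
  by (simp add: energy_eq_integral L2_norm_def)

lemma energy_mono:
  "(\<And>t. cmod (f t) \<le> cmod (g t)) \<Longrightarrow> energy f \<le> energy g"
  unfolding energy_def by (intro nn_integral_mono ennreal_leI power_mono) auto

lemma energy_cong_cmod: "(\<And>t. cmod (f t) = cmod (g t)) \<Longrightarrow> energy f = energy g"
  unfolding energy_def by simp

lemma energy_minus_commute: "energy (\<lambda>t. f t - g t) = energy (\<lambda>t. g t - f t)"
  by (rule energy_cong_cmod) (rule norm_minus_commute)

lemma norm_add_squared_le: "(norm (x + y))\<^sup>2 \<le> 2 * (norm x)\<^sup>2 + 2 * (norm (y::'a::real_normed_vector))\<^sup>2"
proof -
  have "(norm (x + y))\<^sup>2 \<le> (norm x + norm y)\<^sup>2"
    by (intro power_mono norm_triangle_ineq) auto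
  also have "\<dots> \<le> 2 * (norm x)\<^sup>2 + 2 * (norm y)\<^sup>2"
    using zero_le_power2[of "norm x - norm y"] by (simp add: power2_eq_square algebra_simps)
  finally show ?thesis .
qed

lemma energy_add_le:
  assumes [measurable]: "f \<in> borel_measurable borel" "g \<in> borel_measurable borel"
  shows "energy (\<lambda>t. f t + g t) \<le> 2 * energy f + 2 * energy g"
proof -
  have "energy (\<lambda>t. f t + g t) \<le> (\<integral>\<^sup>+t. 2 * ennreal ((cmod (f t))\<^sup>2) + 2 * ennreal ((cmod (g t))\<^sup>2) \<partial>lborel)"
    unfolding energy_def
  proof (intro nn_integral_mono)
    fix t
    have "ennreal ((cmod (f t + g t))\<^sup>2) \<le> ennreal (2 * (cmod (f t))\<^sup>2 + 2 * (cmod (g t))\<^sup>2)"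
      by (intro ennreal_leI norm_add_squared_le)
    also have "\<dots> = 2 * ennreal ((cmod (f t))\<^sup>2) + 2 * ennreal ((cmod (g t))\<^sup>2)"
      by (simp add: ennreal_plus ennreal_mult)
    finally show "ennreal ((cmod (f t + g t))\<^sup>2) \<le> 2 * ennreal ((cmod (f t))\<^sup>2) + 2 * ennreal ((cmod (g t))\<^sup>2)" .
  qed
  also have "\<dots> = 2 * energy f + 2 * energy g"
    unfolding energy_def by (simp add: nn_integral_add nn_integral_cmult)
  finally show ?thesis .
qed

lemma energy_diff_le:
  assumes [measurable]: "f \<in> borel_measurable borel" "g \<in> borel_measurable borel"
  shows "energy (\<lambda>t. f t - g t) \<le> 2 * energy f + 2 * energy g"
  using energy_add_le[of f "\<lambda>t. - g t"] energy_cong_cmod[of "\<lambda>t. - g t" g] by simp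

lemma energy_triangle:
  assumes [measurable]: "f \<in> borel_measurable borel" "g \<in> borel_measurable borel" "h \<in> borel_measurable borel"
  shows "energy (\<lambda>t. f t - h t) \<le> 2 * energy (\<lambda>t. f t - g t) + 2 * energy (\<lambda>t. g t - h t)"
  using energy_add_le[of "\<lambda>t. f t - g t" "\<lambda>t. g t - h t"] by simp

lemma L2_diff:
  assumes "f \<in> L2" "g \<in> L2"
  shows "(\<lambda>t. f t - g t) \<in> L2"
proof -
  have [measurable]: "f \<in> borel_measurable borel" "g \<in> borel_measurable borel"
    using assms by (auto simp: L2_def)
  have "2 * energy f + 2 * energy g < \<infinity>"
    using assms by (simp add: L2_iff_energy ennreal_mult_less_top)
  with energy_diff_le[of f g] have "energy (\<lambda>t. f t - g t) < \<infinity>"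
    by (rule le_less_trans) measurable
  then show ?thesis by (simp add: L2_iff_energy emeasure_lborel_Icc_eq)
qed

lemma borel_measurable_cnj [measurable (raw)]:
  "f \<in> borel_measurable M \<Longrightarrow> (\<lambda>x. cnj (f x)) \<in> borel_measurable M"
  by (rule measurable_compose[OF _ borel_measurable_continuous_onI]) (auto intro: continuous_intros)

lemma L2_cnj: "f \<in> L2 \<Longrightarrow> (\<lambda>t. cnj (f t)) \<in> L2"
  by (auto simp: L2_def)

lemma L2_indicator_interval: "(\<lambda>t. indicator {a..b} t) \<in> L2"
proof -
  have "energy (\<lambda>t. indicator {a..b} t) = (\<integral>\<^sup>+t. indicator {a..b} t \<partial>lborel)"
    unfolding energy_def by (intro nn_integral_cong) (auto simp: indicator_def)
  then show ?thesis by (simp add: L2_iff_energy emeasure_lborel_Icc_eq)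
qed

lemma L2_bounded_mult:
  assumes "f \<in> L2" and [measurable]: "m \<in> borel_measurable borel" and "\<And>t. cmod (m t) \<le> 1"
  shows "(\<lambda>t. m t * f t) \<in> L2"
proof -
  have "energy (\<lambda>t. m t * f t) \<le> energy f"
    using assms(3) by (intro energy_mono) (auto simp: norm_mult mult_left_le_one_le)
  then show ?thesis
    using assms(1) by (auto simp: L2_iff_energy)
qed

lemma L2_restrict:
  assumes "f \<in> L2" and "S \<in> sets borel"
  shows "(\<lambda>t. indicator S t * f t) \<in> L2"
  using assms by (intro L2_bounded_mult) (auto simp: indicator_def)

text \<open>
  The quadratic polynomial \<open>x \<mapsto> \<integral>(x |f| - |g|)\<^sup>2\<close> is nonnegative, hence its discriminant is not positive.
\<close>

lemma nn_integral_Cauchy_Schwarz: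
  assumes "f \<in> L2" "g \<in> L2"
  shows "(\<integral>\<^sup>+t. ennreal (cmod (f t) * cmod (g t)) \<partial>lborel)\<^sup>2 \<le> energy f * energy g"
proof -
  have [measurable]: "f \<in> borel_measurable borel" "g \<in> borel_measurable borel"
    and fi: "integrable lborel (\<lambda>t. (cmod (f t))\<^sup>2)" and gi: "integrable lborel (\<lambda>t. (cmod (g t))\<^sup>2)"
    using assms by (auto simp: L2_def)
  have fgi: "integrable lborel (\<lambda>t. cmod (f t) * cmod (g t))"
  proof (rule Bochner_Integration.integrable_bound)
    show "integrable lborel (\<lambda>t. (cmod (f t))\<^sup>2 + (cmod (g t))\<^sup>2)"
      using fi gi by simp
    show "AE t in lborel. norm (cmod (f t) * cmod (g t)) \<le> norm ((cmod (f t))\<^sup>2 + (cmod (g t))\<^sup>2)"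
    proof (intro AE_I2)
      fix t
      have "2 * (cmod (f t) * cmod (g t)) \<le> (cmod (f t))\<^sup>2 + (cmod (g t))\<^sup>2"
        using sum_squares_bound[of "cmod (f t)" "cmod (g t)"] by simp
      moreover have "0 \<le> cmod (f t) * cmod (g t)" by simp
      ultimately show "norm (cmod (f t) * cmod (g t)) \<le> norm ((cmod (f t))\<^sup>2 + (cmod (g t))\<^sup>2)"
        unfolding real_norm_def by linarith
    qed
  qed measurable
  define a where "a = (LINT t|lborel. (cmod (f t))\<^sup>2)"
  define b where "b = (LINT t|lborel. cmod (f t) * cmod (g t))"
  define c where "c = (LINT t|lborel. (cmod (g t))\<^sup>2)"
  have "0 \<le> a" "0 \<le> b" "0 \<le> c" by (auto simp: a_def b_def c_def)
  have q: "0 \<le> a * x\<^sup>2 + (-2 * b) * x + c" for x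
  proof -
    have "0 \<le> (LINT t|lborel. (x * cmod (f t) - cmod (g t))\<^sup>2)" by simp
    also have "\<dots> = (LINT t|lborel. x\<^sup>2 * (cmod (f t))\<^sup>2 - 2 * x * (cmod (f t) * cmod (g t)) + (cmod (g t))\<^sup>2)"
      by (intro Bochner_Integration.integral_cong) (auto simp: power2_eq_square algebra_simps)
    also have "\<dots> = x\<^sup>2 * a - 2 * x * b + c"
      using fi gi fgi by (simp add: a_def b_def c_def)
    finally show ?thesis by (simp add: algebra_simps)
  qed
  have "b\<^sup>2 \<le> a * c"
  proof (cases "a = 0")
    case True
    have "b = 0"
    proof (rule ccontr)
      assume "b \<noteq> 0"
      then show False using q[of "(c + 1) / (2 * b)"] True by simp
    qed
    then show ?thesis using True by simp
  next
    case False
    then have "a > 0" using \<open>0 \<le> a\<close> by simp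
    from q[of "b / a"] have "0 \<le> c - b\<^sup>2 / a"
      using \<open>a > 0\<close> by (simp add: power2_eq_square field_simps)
    then show ?thesis using \<open>a > 0\<close> by (simp add: field_simps)
  qed
  moreover have "(\<integral>\<^sup>+t. ennreal (cmod (f t) * cmod (g t)) \<partial>lborel) = ennreal b"
    unfolding b_def by (intro nn_integral_eq_integral fgi) auto
  ultimately show ?thesis
    using assms \<open>0 \<le> a\<close> \<open>0 \<le> b\<close> \<open>0 \<le> c\<close>
    by (simp add: energy_eq_integral a_def c_def flip: ennreal_mult) (simp add: ennreal_power ennreal_leI)
qed

lemma L2_mult_integrable:
  assumes "f \<in> L2" "g \<in> L2"
  shows "integrable lborel (\<lambda>t. f t * g t)"
proof -
  have [measurable]: "f \<in> borel_measurable borel" "g \<in> borel_measurable borel"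
    using assms by (auto simp: L2_def)
  have "energy f * energy g < \<infinity>"
    using assms by (auto simp: L2_iff_energy ennreal_mult_less_top)
  then have "(\<integral>\<^sup>+t. ennreal (cmod (f t) * cmod (g t)) \<partial>lborel)\<^sup>2 < \<infinity>"
    using nn_integral_Cauchy_Schwarz[OF assms] by simp
  then have "(\<integral>\<^sup>+t. ennreal (cmod (f t) * cmod (g t)) \<partial>lborel) < \<infinity>"
    by (auto simp: power2_eq_square ennreal_mult_less_top)
  then show ?thesis
    by (auto simp: integrable_iff_bounded norm_mult)
qed

lemma Cauchy_Schwarz_energy:
  assumes "f \<in> L2" "g \<in> L2"
  shows "ennreal ((cmod (LINT t|lborel. f t * g t))\<^sup>2) \<le> energy f * energy g"
proof -
  have "ennreal (cmod (LINT t|lborel. f t * g t)) \<le> (\<integral>\<^sup>+t. ennreal (cmod (f t) * cmod (g t)) \<partial>lborel)"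
    using integral_norm_bound_ennreal[OF L2_mult_integrable[OF assms]] by (simp add: norm_mult)
  then have "(ennreal (cmod (LINT t|lborel. f t * g t)))\<^sup>2 \<le> (\<integral>\<^sup>+t. ennreal (cmod (f t) * cmod (g t)) \<partial>lborel)\<^sup>2"
    by (intro power_mono) auto
  then show ?thesis
    using nn_integral_Cauchy_Schwarz[OF assms] by (simp add: ennreal_power)
qed

lemma L2_pairing_tendsto:
  assumes F: "\<And>n. F n \<in> L2" and "G \<in> L2" "h \<in> L2"
    and lim: "(\<lambda>n. energy (\<lambda>t. F n t - G t)) \<longlonglongrightarrow> 0"
  shows "(\<lambda>n. LINT t|lborel. F n t * h t) \<longlonglongrightarrow> (LINT t|lborel. G t * h t)"
proof -
  have diff: "(LINT t|lborel. F n t * h t) - (LINT t|lborel. G t * h t) = (LINT t|lborel. (F n t - G t) * h t)" for n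
    using L2_mult_integrable[OF F \<open>h \<in> L2\<close>] L2_mult_integrable[OF \<open>G \<in> L2\<close> \<open>h \<in> L2\<close>]
    by (simp add: left_diff_distrib)
  have "(\<lambda>n. energy (\<lambda>t. F n t - G t) * energy h) \<longlonglongrightarrow> 0"
    using ennreal_tendsto_cmult[OF _ lim, of "energy h"] \<open>h \<in> L2\<close>
    by (simp add: L2_iff_energy mult.commute)
  then have "(\<lambda>n. ennreal ((cmod (LINT t|lborel. (F n t - G t) * h t))\<^sup>2)) \<longlonglongrightarrow> 0"
  proof (rule tendsto_sandwich[OF _ _ tendsto_const, rotated 2])
    show "eventually (\<lambda>n. ennreal ((cmod (LINT t|lborel. (F n t - G t) * h t))\<^sup>2)
        \<le> energy (\<lambda>t. F n t - G t) * energy h) sequentially"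
      by (intro always_eventually allI Cauchy_Schwarz_energy L2_diff F \<open>G \<in> L2\<close> \<open>h \<in> L2\<close>)
  qed simp
  then have "(\<lambda>n. (cmod (LINT t|lborel. (F n t - G t) * h t))\<^sup>2) \<longlonglongrightarrow> 0"
    by (subst (asm) ennreal_0[symmetric], subst (asm) tendsto_ennreal_iff) auto
  then have "(\<lambda>n. cmod (LINT t|lborel. (F n t - G t) * h t)) \<longlonglongrightarrow> 0"
    using tendsto_real_sqrt[of "\<lambda>n. (cmod (LINT t|lborel. (F n t - G t) * h t))\<^sup>2" 0] by simp
  then have "(\<lambda>n. (LINT t|lborel. F n t * h t) - (LINT t|lborel. G t * h t)) \<longlonglongrightarrow> 0"
    unfolding diff by (rule tendsto_norm_zero_cancel)
  then show ?thesis by (rule LIM_zero_cancel)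
qed

text \<open>
  Riesz-Fischer. Along a subsequence the squared increments are at most \<open>4\<^sup>-\<^sup>j\<close> in the mean; with
  the weights \<open>2\<^sup>j\<close> they remain summable almost everywhere, which makes the increments
  themselves geometrically small and the subsequence convergent. Fatou's lemma then bounds the
  distance to the pointwise limit.
\<close>

lemma L2_complete:
  fixes F :: "nat \<Rightarrow> real \<Rightarrow> complex"
  assumes F: "\<And>n. F n \<in> L2"
    and Cauchy: "\<And>\<epsilon>. \<epsilon> > 0 \<Longrightarrow> \<exists>N. \<forall>m\<ge>N. \<forall>n\<ge>N. energy (\<lambda>t. F m t - F n t) \<le> ennreal \<epsilon>"
  obtains G where "G \<in> L2" "(\<lambda>n. energy (\<lambda>t. F n t - G t)) \<longlonglongrightarrow> 0"
proof -
  have [measurable]: "F n \<in> borel_measurable borel" for n using F by (auto simp: L2_def)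
  obtain N where N: "\<And>j m n. m \<ge> N j \<Longrightarrow> n \<ge> N j \<Longrightarrow> energy (\<lambda>t. F m t - F n t) \<le> ennreal ((1/4)^j)"
    using Cauchy[of "(1/4)^j" for j] by (auto simp: choice_iff') metis
  \<comment> \<open>The partial sums make the indices increasing, the summand \<open>j\<close> makes them unbounded.\<close>
  define k where "k j = j + (\<Sum>i\<le>j. N i)" for j
  have k_ge: "N j \<le> k j" for j unfolding k_def by (intro trans_le_add2 member_le_sum) auto
  have k_ge_self: "j \<le> k j" for j unfolding k_def by simp
  have k_mono: "k j \<le> k (Suc j)" for j unfolding k_def by simp
  define d where "d j t = F (k (Suc j)) t - F (k j) t" for j t
  have [measurable]: "d j \<in> borel_measurable borel" for j unfolding d_def by measurable
  have d: "energy (d j) \<le> ennreal ((1/4)^j)" for j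
    unfolding d_def using k_ge[of j] k_mono[of j] by (intro N) auto
  have "(\<integral>\<^sup>+t. (\<Sum>j. ennreal (2^j * (cmod (d j t))\<^sup>2)) \<partial>lborel) = (\<Sum>j. \<integral>\<^sup>+t. ennreal (2^j * (cmod (d j t))\<^sup>2) \<partial>lborel)"
    by (intro nn_integral_suminf) measurable
  also have "\<dots> = (\<Sum>j. ennreal (2^j) * energy (d j))"
    unfolding energy_def by (simp add: ennreal_mult nn_integral_cmult)
  also have "\<dots> \<le> (\<Sum>j. ennreal ((1/2)^j))"
  proof (intro suminf_le)
    fix j :: nat
    have "ennreal (2^j) * energy (d j) \<le> ennreal (2^j) * ennreal ((1/4)^j)"
      by (intro mult_left_mono d) auto
    also have "\<dots> = ennreal ((1/2)^j)"
      by (simp flip: ennreal_mult power_mult_distrib)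
    finally show "ennreal (2^j) * energy (d j) \<le> ennreal ((1/2)^j)" .
  qed auto
  also have "\<dots> = ennreal (\<Sum>j. (1/2)^j)"
    by (intro suminf_ennreal2) (auto intro: summable_geometric)
  also have "\<dots> < \<infinity>" by simp
  finally have "AE t in lborel. (\<Sum>j. ennreal (2^j * (cmod (d j t))\<^sup>2)) \<noteq> \<infinity>"
    by (intro nn_integral_PInf_AE) (auto simp: less_top)
  then have conv: "AE t in lborel. convergent (\<lambda>j. F (k j) t)"
  proof eventually_elim
    fix t assume fin: "(\<Sum>j. ennreal (2^j * (cmod (d j t))\<^sup>2)) \<noteq> \<infinity>"
    have "summable (\<lambda>j. 2^j * (cmod (d j t))\<^sup>2)"
      by (rule summable_suminf_not_top) (use fin in auto)
    then have "(\<lambda>j. 2^j * (cmod (d j t))\<^sup>2) \<longlonglongrightarrow> 0"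
      by (rule summable_LIMSEQ_zero)
    then have ev: "eventually (\<lambda>j. 2^j * (cmod (d j t))\<^sup>2 < 1) sequentially"
      by (rule order_tendstoD) simp
    have "summable (\<lambda>j. d j t)"
    proof (rule summable_comparison_test_ev)
      show "summable (\<lambda>j. (sqrt (1/2))^j)"
        by (intro summable_geometric) (auto simp: real_sqrt_lt_1_iff)
      show "eventually (\<lambda>j. norm (d j t) \<le> (sqrt (1/2))^j) sequentially"
        using ev
      proof eventually_elim
        case (elim j)
        then have "(cmod (d j t))\<^sup>2 \<le> (1/2)^j" by (simp add: field_simps)
        then have "sqrt ((cmod (d j t))\<^sup>2) \<le> sqrt ((1/2)^j)" by (rule real_sqrt_le_mono)
        then show ?case by (simp add: real_sqrt_power)
      qed
    qed
    then have "convergent (\<lambda>n. \<Sum>j<n. d j t)" by (simp add: summable_iff_convergent)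
    moreover have "(\<Sum>j<n. d j t) = F (k n) t - F (k 0) t" for n
      unfolding d_def by (rule sum_lessThan_telescope)
    ultimately have "convergent (\<lambda>n. F (k n) t - F (k 0) t)" by simp
    then show "convergent (\<lambda>j. F (k j) t)"
      using convergent_diff_const_right_iff[of "\<lambda>n. F (k n) t" "F (k 0) t"] by simp
  qed
  define G where "G t = lim (\<lambda>j. F (k j) t)" for t
  have [measurable]: "G \<in> borel_measurable borel" unfolding G_def by measurable
  have lim: "AE t in lborel. (\<lambda>j. F (k j) t) \<longlonglongrightarrow> G t"
    using conv unfolding G_def by (simp add: convergent_LIMSEQ_iff)
  have close: "\<exists>M. \<forall>n\<ge>M. energy (\<lambda>t. F n t - G t) \<le> ennreal \<epsilon>" if "\<epsilon> > 0" for \<epsilon>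
  proof -
    obtain M where M: "\<And>m n. m \<ge> M \<Longrightarrow> n \<ge> M \<Longrightarrow> energy (\<lambda>t. F m t - F n t) \<le> ennreal \<epsilon>"
      using Cauchy[OF \<open>\<epsilon> > 0\<close>] by auto
    have "energy (\<lambda>t. F n t - G t) \<le> ennreal \<epsilon>" if "n \<ge> M" for n
    proof -
      have "energy (\<lambda>t. F n t - G t) = (\<integral>\<^sup>+t. liminf (\<lambda>j. ennreal ((cmod (F n t - F (k j) t))\<^sup>2)) \<partial>lborel)"
        unfolding energy_def
      proof (rule nn_integral_cong_AE, use lim in eventually_elim)
        fix t assume l: "(\<lambda>j. F (k j) t) \<longlonglongrightarrow> G t"
        have "(\<lambda>j. ennreal ((cmod (F n t - F (k j) t))\<^sup>2)) \<longlonglongrightarrow> ennreal ((cmod (F n t - G t))\<^sup>2)"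
          by (intro tendsto_intros tendsto_ennrealI l)
        then show "ennreal ((cmod (F n t - G t))\<^sup>2) = liminf (\<lambda>j. ennreal ((cmod (F n t - F (k j) t))\<^sup>2))"
          by (intro lim_imp_Liminf[symmetric]) auto
      qed
      also have "\<dots> \<le> liminf (\<lambda>j. energy (\<lambda>t. F n t - F (k j) t))"
        unfolding energy_def by (rule nn_integral_liminf) measurable
      also have "\<dots> \<le> limsup (\<lambda>j. energy (\<lambda>t. F n t - F (k j) t))"
        by (rule Liminf_le_Limsup) simp
      also have "\<dots> \<le> ennreal \<epsilon>"
      proof (rule Limsup_bounded)
        show "eventually (\<lambda>j. energy (\<lambda>t. F n t - F (k j) t) \<le> ennreal \<epsilon>) sequentially"
          using eventually_ge_at_top[of M]
        proof eventually_elim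
          case (elim j)
          then show ?case using k_ge_self[of j] \<open>n \<ge> M\<close> by (intro M) auto
        qed
      qed
      finally show ?thesis .
    qed
    then show ?thesis by blast
  qed
  have lim0: "(\<lambda>n. energy (\<lambda>t. F n t - G t)) \<longlonglongrightarrow> 0"
  proof (rule order_tendstoI)
    fix x :: ennreal assume "0 < x"
    then obtain y where "0 < y" "y < x" using dense by blast
    then obtain \<epsilon> where \<epsilon>: "y = ennreal \<epsilon>" "\<epsilon> > 0"
      by (cases y) auto
    from close[OF this(2)] show "eventually (\<lambda>n. energy (\<lambda>t. F n t - G t) < x) sequentially"
      using \<epsilon> \<open>y < x\<close> by (auto simp: eventually_sequentially intro: le_less_trans)
  qed auto
  obtain M where "energy (\<lambda>t. F M t - G t) \<le> ennreal 1" using close[of 1] by auto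
  then have "(\<lambda>t. F M t - G t) \<in> L2" by (auto simp: L2_iff_energy intro: le_less_trans)
  from L2_diff[OF F[of M] this] have "G \<in> L2" by simp
  then show ?thesis using lim0 by (rule that)
qed

text \<open>
  The sets over which a truncation of \<open>f\<close> integrates to zero form a Dynkin system that contains the
  half-lines, which generate the Borel sets.
\<close>

lemma AE_zero_if_interval_integrals_zero:
  fixes f :: "real \<Rightarrow> complex"
  assumes f: "f \<in> L2"
    and zero: "\<And>a b. a \<le> b \<Longrightarrow> (LINT t|lborel. indicator {a..b} t * f t) = 0"
  shows "AE t in lborel. f t = 0"
proof -
  have ind_L2: "(\<lambda>t. indicator {- real N..real N} t :: complex) \<in> L2" for N
    by (rule L2_indicator_interval)
  have int: "integrable lborel (\<lambda>t. indicator {- real N..real N} t * f t)" for N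
    by (rule L2_mult_integrable[OF ind_L2 f])
  have "AE t in lborel. indicator {- real N..real N} t * f t = 0" for N
  proof (rule sigma_finite_measure.density_zero[OF sigma_finite_lborel int])
    fix A :: "real set" assume "A \<in> sets lborel"
    then have "A \<in> sigma_sets UNIV (range (\<lambda>a::real. {..a}))"
      by (simp add: borel_eq_atMost)
    have stable: "Int_stable (range (\<lambda>a::real. {..a}))"
      by (auto simp: Int_stable_def)
    from \<open>A \<in> sigma_sets _ _\<close> show "(LINT t:A|lborel. indicator {- real N..real N} t * f t) = 0"
    proof (induction rule: sigma_sets_induct_disjoint[OF stable, of UNIV, simplified, consumes 1, case_names basic empty compl union])
      case (basic A)
      then obtain a where A: "A = {..a}" by auto
      have "(LINT t:A|lborel. indicator {- real N..real N} t * f t) = (LINT t|lborel. indicator {- real N..min a (real N)} t * f t)"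
        unfolding set_lebesgue_integral_def
        by (intro Bochner_Integration.integral_cong) (auto simp: A indicator_def)
      also have "\<dots> = 0"
        by (cases "- real N \<le> min a (real N)") (use zero in auto)
      finally show ?case .
    next
      case empty then show ?case by (simp add: set_lebesgue_integral_def)
    next
      case (compl A)
      then have [measurable]: "A \<in> sets borel" by (simp add: borel_eq_atMost)
      have "(LINT t:(UNIV - A)|lborel. indicator {- real N..real N} t * f t) = (LINT t|lborel. indicator {- real N..real N} t * f t - indicator A t *\<^sub>R (indicator {- real N..real N} t * f t))"
        unfolding set_lebesgue_integral_def
        by (intro Bochner_Integration.integral_cong) (auto simp: indicator_def)
      also have "\<dots> = (LINT t|lborel. indicator {- real N..real N} t * f t) - (LINT t:A|lborel. indicator {- real N..real N} t * f t)"
        unfolding set_lebesgue_integral_def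
        by (intro Bochner_Integration.integral_diff int integrable_mult_indicator) auto
      also have "\<dots> = 0" using compl zero[of "- real N" "real N"] by simp
      finally show ?case .
    next
      case (union A)
      then have m: "A i \<in> sets borel" for i by (auto simp: borel_eq_atMost)
      have "(LINT t:(\<Union>i. A i)|lborel. indicator {- real N..real N} t * f t) = (\<Sum>i. LINT t:A i|lborel. indicator {- real N..real N} t * f t)"
      proof (rule lebesgue_integral_countable_add)
        show "A i \<in> sets lborel" for i using m by simp
        show "A i \<inter> A j = {}" if "i \<noteq> j" for i j using union that by (auto simp: disjoint_family_on_def)
        show "set_integrable lborel (\<Union>i. A i) (\<lambda>t. indicator {- real N..real N} t * f t)"
          unfolding set_integrable_def by (intro integrable_mult_indicator int) (use m in auto)
      qed
      also have "\<dots> = 0" using union by simp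
      finally show ?case .
    qed
  qed
  then have "AE t in lborel. \<forall>N. indicator {- real N..real N} t * f t = 0"
    by (simp only: AE_all_countable) simp
  then show ?thesis
  proof eventually_elim
    fix t assume *: "\<forall>N. indicator {- real N..real N} t * f t = 0"
    obtain N :: nat where "\<bar>t\<bar> \<le> real N" using real_arch_simple by blast
    then show "f t = 0" using *[rule_format, of N] by (auto simp: indicator_def)
  qed
qed

section \<open>Fourier integrals and Gaussian damping\<close>

lemma fourier_kernel_eq_cis:
  "exp (- 2 * of_real pi * \<i> * of_real t * of_real \<xi>) = cis (- (2 * pi * t * \<xi>))"
  by (simp add: cis_conv_exp mult_ac)

lemma fourier_integral_eq_cis:
  "fourier_integral f \<xi> = (LINT t|lborel. f t * cis (- (2 * pi * t * \<xi>)))"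
  unfolding fourier_integral_def by (simp only: fourier_kernel_eq_cis)

lemma borel_measurable_cis [measurable (raw)]:
  "f \<in> borel_measurable M \<Longrightarrow> (\<lambda>x. cis (f x)) \<in> borel_measurable M"
  by (rule measurable_compose[OF _ borel_measurable_continuous_onI]) (auto intro: continuous_intros)

lemma integrable_mult_cis:
  fixes f :: "real \<Rightarrow> complex"
  assumes "integrable lborel f" and [measurable]: "g \<in> borel_measurable borel"
  shows "integrable lborel (\<lambda>t. f t * cis (g t))"
  by (rule Bochner_Integration.integrable_bound[OF assms(1)])
     (use borel_measurable_integrable[OF assms(1)] in \<open>auto simp: norm_mult\<close>)

lemma fourier_integral_measurable [measurable]:
  assumes [measurable]: "f \<in> borel_measurable borel"
  shows "fourier_integral f \<in> borel_measurable borel"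
proof -
  have "fourier_integral f = (\<lambda>\<xi>. LINT t|lborel. f t * cis (- (2 * pi * t * \<xi>)))"
    by (rule ext) (rule fourier_integral_eq_cis)
  then show ?thesis by simp
qed

lemma norm_fourier_integral_le:
  "cmod (fourier_integral f \<xi>) \<le> (LINT t|lborel. cmod (f t))"
  using integral_norm_bound[of lborel "\<lambda>t. f t * cis (- (2 * pi * t * \<xi>))"]
  by (simp add: fourier_integral_eq_cis norm_mult)

lemma fourier_integral_diff:
  assumes "integrable lborel f" "integrable lborel g"
  shows "fourier_integral (\<lambda>t. f t - g t) \<xi> = fourier_integral f \<xi> - fourier_integral g \<xi>"
  unfolding fourier_integral_eq_cis
  using integrable_mult_cis[OF assms(1), of "\<lambda>t. - (2 * pi * t * \<xi>)"] integrable_mult_cis[OF assms(2), of "\<lambda>t. - (2 * pi * t * \<xi>)"]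
  by (simp add: left_diff_distrib)

lemma integrable_bounded_mult:
  fixes f g :: "real \<Rightarrow> complex"
  assumes "integrable lborel f" and [measurable]: "g \<in> borel_measurable borel" and "\<And>t. cmod (g t) \<le> K"
  shows "integrable lborel (\<lambda>t. g t * f t)"
proof (rule Bochner_Integration.integrable_bound)
  show "integrable lborel (\<lambda>t. K * cmod (f t))" using assms(1) by simp
  show "AE t in lborel. norm (g t * f t) \<le> norm (K * cmod (f t))"
    using order_trans[OF norm_ge_zero assms(3)] by (auto simp: norm_mult abs_mult intro!: mult_right_mono assms(3) order_trans[OF _ abs_ge_self])
qed (use borel_measurable_integrable[OF assms(1)] in measurable)

lemma fourier_integral_mult_integrable:
  assumes "integrable lborel f" "integrable lborel \<psi>"
  shows "integrable lborel (\<lambda>\<xi>. fourier_integral f \<xi> * \<psi> \<xi>)"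
  using borel_measurable_integrable[OF assms(1)]
  by (intro integrable_bounded_mult[OF assms(2), where K = "LINT t|lborel. cmod (f t)"] norm_fourier_integral_le) auto

text \<open>
  Fubini's theorem for the kernel, which is symmetric in time and frequency. All duality between the two
  sides is derived from this identity.
\<close>

lemma fourier_multiplication_formula:
  assumes f: "integrable lborel f" and \<psi>: "integrable lborel \<psi>"
  shows "(LINT \<xi>|lborel. fourier_integral f \<xi> * \<psi> \<xi>) = (LINT t|lborel. f t * fourier_integral \<psi> t)"
proof -
  have [measurable]: "f \<in> borel_measurable borel" "\<psi> \<in> borel_measurable borel"
    using f \<psi> by auto
  have "integrable (lborel \<Otimes>\<^sub>M lborel) (\<lambda>(t, \<xi>). f t * cis (- (2 * pi * t * \<xi>)) * \<psi> \<xi>)"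
  proof (rule lborel_pair.Fubini_integrable)
    show "integrable lborel (\<lambda>t. LINT \<xi>|lborel. norm (case (t, \<xi>) of (t, \<xi>) \<Rightarrow> f t * cis (- (2 * pi * t * \<xi>)) * \<psi> \<xi>))"
      using f \<psi> by (simp add: norm_mult)
    have "integrable lborel (\<lambda>\<xi>. f t * (\<psi> \<xi> * cis (- (2 * pi * t * \<xi>))))" for t
      by (intro integrable_mult_right integrable_mult_cis \<psi>) measurable
    then show "AE t in lborel. integrable lborel (\<lambda>\<xi>. case (t, \<xi>) of (t, \<xi>) \<Rightarrow> f t * cis (- (2 * pi * t * \<xi>)) * \<psi> \<xi>)"
      by (simp add: mult_ac)
  qed measurable
  from lborel_pair.Fubini_integral[OF this]
  have "(LINT \<xi>|lborel. LINT t|lborel. f t * cis (- (2 * pi * t * \<xi>)) * \<psi> \<xi>) = (LINT t|lborel. LINT \<xi>|lborel. f t * cis (- (2 * pi * t * \<xi>)) * \<psi> \<xi>)" .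
  moreover have "(LINT t|lborel. f t * cis (- (2 * pi * t * \<xi>)) * \<psi> \<xi>) = fourier_integral f \<xi> * \<psi> \<xi>" for \<xi>
    by (simp add: fourier_integral_eq_cis)
  moreover have "(LINT \<xi>|lborel. f t * cis (- (2 * pi * t * \<xi>)) * \<psi> \<xi>) = f t * fourier_integral \<psi> t" for t
  proof -
    have "(LINT \<xi>|lborel. f t * cis (- (2 * pi * t * \<xi>)) * \<psi> \<xi>) = (LINT \<xi>|lborel. f t * (\<psi> \<xi> * cis (- (2 * pi * \<xi> * t))))"
      by (simp add: mult_ac)
    then show ?thesis by (simp add: fourier_integral_eq_cis)
  qed
  ultimately show ?thesis by (simp only:)
qed

text \<open>
  The Gaussian that is its own Fourier transform and has integral 1.
\<close>

definition gauss :: "real \<Rightarrow> real" where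
  "gauss x = exp (- pi * x\<^sup>2)"

lemma gauss_measurable [measurable]: "gauss \<in> borel_measurable borel"
  unfolding gauss_def by measurable

lemma gauss_pos [simp]: "gauss x > 0" and gauss_nonneg [simp]: "gauss x \<ge> 0" and gauss_le_1: "gauss x \<le> 1"
  by (auto simp: gauss_def)

lemma gauss_minus: "gauss (x - y) = gauss (y - x)"
  by (simp add: gauss_def power2_commute)

lemma gauss_normal_density: "gauss x = sqrt (2 * pi) * normal_density 0 1 (sqrt (2 * pi) * x)"
  by (simp add: gauss_def normal_density_def power_mult_distrib real_sqrt_mult)

lemma gauss_integrable: "integrable lborel gauss"
  and gauss_integral: "(LINT x|lborel. gauss x) = 1"
proof -
  have c: "sqrt (2 * pi) \<noteq> 0" by simp
  have i: "integrable lborel (normal_density 0 1)" by (rule integrable_normal_density) simp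
  have g: "gauss = (\<lambda>x. sqrt (2 * pi) * normal_density 0 1 (0 + sqrt (2 * pi) * x))"
    by (rule ext) (simp add: gauss_normal_density)
  show "integrable lborel gauss"
    unfolding g by (intro integrable_mult_right lborel_integrable_real_affine[OF i c])
  have "(LINT x|lborel. normal_density 0 1 x) = \<bar>sqrt (2 * pi)\<bar> *\<^sub>R (LINT x|lborel. normal_density 0 1 (0 + sqrt (2 * pi) * x))"
    by (rule lborel_integral_real_affine[OF c])
  then show "(LINT x|lborel. gauss x) = 1"
    by (simp add: gauss_normal_density integral_normal_density)
qed

lemma gauss_scaled_integrable: "\<epsilon> \<noteq> 0 \<Longrightarrow> integrable lborel (\<lambda>x. gauss (c + \<epsilon> * x))"
  by (rule lborel_integrable_real_affine[OF gauss_integrable])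

text \<open>
  A rescaling of the characteristic function of the standard normal distribution.
\<close>

lemma fourier_integral_gauss:
  "fourier_integral (\<lambda>t. complex_of_real (gauss t)) \<xi> = complex_of_real (gauss \<xi>)"
proof -
  define s where "s = - (sqrt (2 * pi) * \<xi>)"
  have c: "sqrt (2 * pi) \<noteq> 0" by simp
  have "complex_of_real (exp (- (s\<^sup>2) / 2)) = char std_normal_distribution s"
    by (simp add: char_std_normal_distribution)
  also have "\<dots> = (LINT x|lborel. normal_density 0 1 x *\<^sub>R iexp (s * x))"
    unfolding char_def by (subst integral_density) (auto simp: normal_density_nonneg)
  also have "\<dots> = \<bar>sqrt (2 * pi)\<bar> *\<^sub>R (LINT x|lborel. normal_density 0 1 (0 + sqrt (2 * pi) * x) *\<^sub>R iexp (s * (0 + sqrt (2 * pi) * x)))"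
    by (rule lborel_integral_real_affine[OF c])
  also have "\<dots> = (LINT x|lborel. sqrt (2 * pi) *\<^sub>R normal_density 0 1 (0 + sqrt (2 * pi) * x) *\<^sub>R iexp (s * (0 + sqrt (2 * pi) * x)))"
    by (subst integral_scaleR_right) simp
  also have "\<dots> = (LINT x|lborel. complex_of_real (gauss x) * cis (- (2 * pi * x * \<xi>)))"
  proof (intro Bochner_Integration.integral_cong refl)
    fix x
    have "s * (0 + sqrt (2 * pi) * x) = - (sqrt (2 * pi) * sqrt (2 * pi) * x * \<xi>)"
      by (simp add: s_def)
    also have "\<dots> = - (2 * pi * x * \<xi>)" by simp
    finally have "iexp (s * (0 + sqrt (2 * pi) * x)) = cis (- (2 * pi * x * \<xi>))"
      by (simp add: cis_conv_exp)
    then show "sqrt (2 * pi) *\<^sub>R normal_density 0 1 (0 + sqrt (2 * pi) * x) *\<^sub>R iexp (s * (0 + sqrt (2 * pi) * x)) = complex_of_real (gauss x) * cis (- (2 * pi * x * \<xi>))"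
      by (simp add: gauss_normal_density scaleR_conv_of_real)
  qed
  also have "\<dots> = fourier_integral (\<lambda>t. complex_of_real (gauss t)) \<xi>"
    by (simp add: fourier_integral_eq_cis)
  finally have "fourier_integral (\<lambda>t. complex_of_real (gauss t)) \<xi> = complex_of_real (exp (- (s\<^sup>2) / 2))" ..
  also have "- (s\<^sup>2) / 2 = - pi * \<xi>\<^sup>2" by (simp add: s_def power_mult_distrib)
  finally show ?thesis by (simp add: gauss_def)
qed

text \<open>
  The transform of the damping factor \<open>gauss (\<epsilon> * \<xi>)\<close>: an approximate identity as
  \<open>\<epsilon>\<close> tends to 0.
\<close>

definition gauss_kernel :: "real \<Rightarrow> real \<Rightarrow> real" where
  "gauss_kernel \<epsilon> x = gauss (x / \<epsilon>) / \<epsilon>"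

lemma gauss_kernel_measurable [measurable]: "gauss_kernel \<epsilon> \<in> borel_measurable borel"
  unfolding gauss_kernel_def by measurable

lemma gauss_kernel_nonneg: "\<epsilon> > 0 \<Longrightarrow> gauss_kernel \<epsilon> x \<ge> 0"
  by (simp add: gauss_kernel_def)

lemma gauss_kernel_integrable: "\<epsilon> > 0 \<Longrightarrow> integrable lborel (\<lambda>u. gauss_kernel \<epsilon> (t - u))"
  using gauss_scaled_integrable[of "- 1 / \<epsilon>" "t / \<epsilon>"]
  by (simp add: gauss_kernel_def diff_divide_distrib)

lemma gauss_kernel_integral: "\<epsilon> > 0 \<Longrightarrow> (LINT u|lborel. gauss_kernel \<epsilon> (t - u)) = 1"
  using lborel_integral_real_affine[of "- 1 / \<epsilon>" gauss "t / \<epsilon>"]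
  by (simp add: gauss_kernel_def diff_divide_distrib gauss_integral)

lemma fourier_integral_gauss_scaled:
  assumes "\<epsilon> > 0"
  shows "fourier_integral (\<lambda>\<xi>. complex_of_real (gauss (\<epsilon> * \<xi>)) * cis (- (2 * pi * \<xi> * t))) u = complex_of_real (gauss_kernel \<epsilon> (t + u))"
proof -
  have "complex_of_real (gauss ((t + u) / \<epsilon>)) = (LINT x|lborel. complex_of_real (gauss x) * cis (- (2 * pi * x * ((t + u) / \<epsilon>))))"
    using fourier_integral_gauss[of "(t + u) / \<epsilon>"] by (simp add: fourier_integral_eq_cis)
  also have "\<dots> = \<bar>\<epsilon>\<bar> *\<^sub>R (LINT x|lborel. complex_of_real (gauss (0 + \<epsilon> * x)) * cis (- (2 * pi * (0 + \<epsilon> * x) * ((t + u) / \<epsilon>))))"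
    using assms by (intro lborel_integral_real_affine) simp
  also have "(LINT x|lborel. complex_of_real (gauss (0 + \<epsilon> * x)) * cis (- (2 * pi * (0 + \<epsilon> * x) * ((t + u) / \<epsilon>)))) =
      fourier_integral (\<lambda>\<xi>. complex_of_real (gauss (\<epsilon> * \<xi>)) * cis (- (2 * pi * \<xi> * t))) u"
    unfolding fourier_integral_eq_cis
  proof (intro Bochner_Integration.integral_cong refl)
    fix x
    have "- (2 * pi * (0 + \<epsilon> * x) * ((t + u) / \<epsilon>)) = - (2 * pi * x * t) + - (2 * pi * x * u)"
      using assms by (simp add: field_simps)
    then show "complex_of_real (gauss (0 + \<epsilon> * x)) * cis (- (2 * pi * (0 + \<epsilon> * x) * ((t + u) / \<epsilon>))) =
        complex_of_real (gauss (\<epsilon> * x)) * cis (- (2 * pi * x * t)) * cis (- (2 * pi * x * u))"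
      by (simp add: mult.assoc cis_mult)
  qed
  finally show ?thesis
    using assms by (simp add: gauss_kernel_def scaleR_conv_of_real)
qed

text \<open>
  For integrable \<open>f\<close> and \<open>g\<close> the product of the transforms need not be integrable; the Gaussian factor
  makes it so. Two applications of the multiplication formula then move both transforms to the
  Gaussian, where they become convolution with the Gaussian kernel.
\<close>

lemma fourier_damped_Parseval:
  assumes f: "integrable lborel f" and g: "integrable lborel g" and "\<epsilon> > 0"
  shows "(LINT \<xi>|lborel. fourier_integral f \<xi> * cnj (fourier_integral g \<xi>) * complex_of_real (gauss (\<epsilon> * \<xi>))) =
         (LINT t|lborel. f t * (LINT u|lborel. cnj (g u) * complex_of_real (gauss_kernel \<epsilon> (t - u))))"
proof -
  \<comment> \<open>Conjugating a transform amounts to transforming the conjugated reflection.\<close>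
  define g' where "g' t = cnj (g (- t))" for t
  have [measurable]: "g \<in> borel_measurable borel" using g by auto
  have g'i: "integrable lborel g'"
    using lborel_integrable_real_affine[OF g, of "-1" 0] unfolding g'_def by simp
  have cnj_g: "cnj (fourier_integral g \<xi>) = fourier_integral g' \<xi>" for \<xi>
  proof -
    have "cnj (fourier_integral g \<xi>) = (LINT t|lborel. cnj (g t * cis (- (2 * pi * t * \<xi>))))"
      unfolding fourier_integral_eq_cis by (rule Bochner_Integration.integral_cnj[symmetric])
    also have "\<dots> = (LINT t|lborel. cnj (g t) * cis (2 * pi * t * \<xi>))"
      by (simp add: cis_cnj)
    also have "\<dots> = (LINT t|lborel. cnj (g (0 + (-1) * t)) * cis (2 * pi * (0 + (-1) * t) * \<xi>))"
      by (subst lborel_integral_real_affine[of "-1" _ 0]) auto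
    finally show ?thesis by (simp add: fourier_integral_eq_cis g'_def)
  qed
  define \<gamma> where "\<gamma> t \<xi> = complex_of_real (gauss (\<epsilon> * \<xi>)) * cis (- (2 * pi * \<xi> * t))" for t \<xi>
  have \<gamma>i: "integrable lborel (\<gamma> t)" for t
    unfolding \<gamma>_def using gauss_scaled_integrable[of \<epsilon> 0] \<open>\<epsilon> > 0\<close>
    by (intro integrable_mult_cis) auto
  define \<psi> where "\<psi> \<xi> = fourier_integral g' \<xi> * \<gamma> 0 \<xi>" for \<xi>
  have \<psi>i: "integrable lborel \<psi>"
    unfolding \<psi>_def by (rule fourier_integral_mult_integrable[OF g'i \<gamma>i])
  have "(LINT \<xi>|lborel. fourier_integral f \<xi> * cnj (fourier_integral g \<xi>) * complex_of_real (gauss (\<epsilon> * \<xi>))) = (LINT \<xi>|lborel. fourier_integral f \<xi> * \<psi> \<xi>)"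
    by (simp add: \<psi>_def cnj_g \<gamma>_def mult.assoc)
  also have "\<dots> = (LINT t|lborel. f t * fourier_integral \<psi> t)"
    by (rule fourier_multiplication_formula[OF f \<psi>i])
  finally have "(LINT \<xi>|lborel. fourier_integral f \<xi> * cnj (fourier_integral g \<xi>) * complex_of_real (gauss (\<epsilon> * \<xi>))) =
      (LINT t|lborel. f t * fourier_integral \<psi> t)" .
  moreover have "fourier_integral \<psi> t = (LINT u|lborel. cnj (g u) * complex_of_real (gauss_kernel \<epsilon> (t - u)))" for t
  proof -
    have "fourier_integral \<psi> t = (LINT \<xi>|lborel. fourier_integral g' \<xi> * \<gamma> t \<xi>)"
      by (simp add: fourier_integral_eq_cis[of \<psi>] \<psi>_def \<gamma>_def mult.assoc)
    also have "\<dots> = (LINT u|lborel. g' u * fourier_integral (\<gamma> t) u)"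
      by (rule fourier_multiplication_formula[OF g'i \<gamma>i])
    also have "\<dots> = (LINT u|lborel. g' u * complex_of_real (gauss_kernel \<epsilon> (t + u)))"
      unfolding \<gamma>_def by (simp add: fourier_integral_gauss_scaled[OF \<open>\<epsilon> > 0\<close>])
    also have "\<dots> = (LINT u|lborel. g' (0 + (-1) * u) * complex_of_real (gauss_kernel \<epsilon> (t + (0 + (-1) * u))))"
      by (subst lborel_integral_real_affine[of "-1" _ 0]) auto
    finally show ?thesis by (simp add: g'_def)
  qed
  ultimately show ?thesis by (simp only:)
qed

section \<open>The Fourier transform of square-integrable functions\<close>

lemma norm_integral_le_nn_integral:
  "ennreal (norm (integral\<^sup>L M f)) \<le> (\<integral>\<^sup>+x. ennreal (norm (f x)) \<partial>M)"
  by (cases "integrable M f") (auto simp: integral_norm_bound_ennreal not_integrable_integral_eq)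

lemma gauss_tendsto_1: "(\<lambda>n. gauss (x / real (Suc n))) \<longlonglongrightarrow> 1"
proof -
  have "(\<lambda>n. exp (- pi * (x / real (Suc n))\<^sup>2)) \<longlonglongrightarrow> exp (- pi * 0\<^sup>2)"
    by (intro tendsto_intros LIMSEQ_Suc[OF lim_const_over_n])
  then show ?thesis by (simp add: gauss_def)
qed

lemma gauss_kernel_nn_integral:
  assumes "\<epsilon> > 0"
  shows "(\<integral>\<^sup>+u. ennreal (gauss_kernel \<epsilon> (t - u)) \<partial>lborel) = 1"
  using nn_integral_eq_integral[OF gauss_kernel_integrable[OF assms]] gauss_kernel_nonneg[OF assms]
  by (simp add: gauss_kernel_integral[OF assms])

lemma gauss_kernel_minus: "gauss_kernel \<epsilon> (t - u) = gauss_kernel \<epsilon> (u - t)"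
  by (simp add: gauss_kernel_def diff_divide_distrib gauss_minus)

text \<open>
  Schur's test: \<open>|f t| |f u| \<le> |f t|\<^sup>2 / 2 + |f u|\<^sup>2 / 2\<close>, and the kernel has mass 1 in
  each variable.
\<close>

lemma smoothing_quadratic_form_le:
  assumes [measurable]: "f \<in> borel_measurable borel" and "\<epsilon> > 0"
  shows "ennreal (cmod (LINT t|lborel. f t * (LINT u|lborel. cnj (f u) * complex_of_real (gauss_kernel \<epsilon> (t - u))))) \<le> energy f"
proof -
  let ?K = "\<lambda>t u. gauss_kernel \<epsilon> (t - u)"
  have K: "?K t u \<ge> 0" for t u using gauss_kernel_nonneg[OF \<open>\<epsilon> > 0\<close>] .
  have "ennreal (cmod (LINT t|lborel. f t * (LINT u|lborel. cnj (f u) * complex_of_real (?K t u))))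
      \<le> (\<integral>\<^sup>+t. ennreal (cmod (f t * (LINT u|lborel. cnj (f u) * complex_of_real (?K t u)))) \<partial>lborel)"
    by (rule norm_integral_le_nn_integral)
  also have "\<dots> \<le> (\<integral>\<^sup>+t. (\<integral>\<^sup>+u. ennreal ((cmod (f t))\<^sup>2 / 2) * ennreal (?K t u) + ennreal ((cmod (f u))\<^sup>2 / 2) * ennreal (?K t u) \<partial>lborel) \<partial>lborel)"
  proof (intro nn_integral_mono)
    fix t
    have "ennreal (cmod (f t * (LINT u|lborel. cnj (f u) * complex_of_real (?K t u))))
        \<le> ennreal (cmod (f t)) * (\<integral>\<^sup>+u. ennreal (cmod (cnj (f u) * complex_of_real (?K t u))) \<partial>lborel)"
      unfolding norm_mult[of "f t"] ennreal_mult[OF norm_ge_zero norm_ge_zero]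
      by (intro mult_left_mono norm_integral_le_nn_integral) auto
    also have "\<dots> = (\<integral>\<^sup>+u. ennreal (cmod (f t)) * ennreal (cmod (cnj (f u) * complex_of_real (?K t u))) \<partial>lborel)"
      by (subst nn_integral_cmult) auto
    also have "\<dots> \<le> (\<integral>\<^sup>+u. ennreal ((cmod (f t))\<^sup>2 / 2) * ennreal (?K t u) + ennreal ((cmod (f u))\<^sup>2 / 2) * ennreal (?K t u) \<partial>lborel)"
    proof (intro nn_integral_mono)
      fix u
      have "cmod (f t) * cmod (f u) \<le> (cmod (f t))\<^sup>2 / 2 + (cmod (f u))\<^sup>2 / 2"
        using sum_squares_bound[of "cmod (f t)" "cmod (f u)"] by simp
      then have "cmod (f t) * cmod (f u) * ?K t u \<le> ((cmod (f t))\<^sup>2 / 2 + (cmod (f u))\<^sup>2 / 2) * ?K t u"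
        by (intro mult_right_mono K)
      then have "ennreal (cmod (f t) * cmod (f u) * ?K t u) \<le> ennreal ((cmod (f t))\<^sup>2 / 2 * ?K t u + (cmod (f u))\<^sup>2 / 2 * ?K t u)"
        by (intro ennreal_leI) (simp add: algebra_simps)
      then show "ennreal (cmod (f t)) * ennreal (cmod (cnj (f u) * complex_of_real (?K t u))) \<le> ennreal ((cmod (f t))\<^sup>2 / 2) * ennreal (?K t u) + ennreal ((cmod (f u))\<^sup>2 / 2) * ennreal (?K t u)"
        using K[of t u] by (simp add: norm_mult ennreal_mult[symmetric] ennreal_plus[symmetric] mult.assoc del: ennreal_plus)
    qed
    finally show "ennreal (cmod (f t * (LINT u|lborel. cnj (f u) * complex_of_real (?K t u))))
        \<le> (\<integral>\<^sup>+u. ennreal ((cmod (f t))\<^sup>2 / 2) * ennreal (?K t u) + ennreal ((cmod (f u))\<^sup>2 / 2) * ennreal (?K t u) \<partial>lborel)" .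
  qed
  also have "\<dots> = (\<integral>\<^sup>+t. (\<integral>\<^sup>+u. ennreal ((cmod (f t))\<^sup>2 / 2) * ennreal (?K t u) \<partial>lborel) \<partial>lborel) +
      (\<integral>\<^sup>+t. (\<integral>\<^sup>+u. ennreal ((cmod (f u))\<^sup>2 / 2) * ennreal (?K t u) \<partial>lborel) \<partial>lborel)"
    by (simp add: nn_integral_add)
  also have "(\<integral>\<^sup>+t. (\<integral>\<^sup>+u. ennreal ((cmod (f t))\<^sup>2 / 2) * ennreal (?K t u) \<partial>lborel) \<partial>lborel) = (\<integral>\<^sup>+t. ennreal ((cmod (f t))\<^sup>2 / 2) \<partial>lborel)"
    by (simp add: nn_integral_cmult gauss_kernel_nn_integral[OF \<open>\<epsilon> > 0\<close>])
  also have "(\<integral>\<^sup>+t. (\<integral>\<^sup>+u. ennreal ((cmod (f u))\<^sup>2 / 2) * ennreal (?K t u) \<partial>lborel) \<partial>lborel) =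
      (\<integral>\<^sup>+u. (\<integral>\<^sup>+t. ennreal ((cmod (f u))\<^sup>2 / 2) * ennreal (?K t u) \<partial>lborel) \<partial>lborel)"
    by (rule lborel_pair.Fubini'[symmetric]) measurable
  also have "\<dots> = (\<integral>\<^sup>+t. ennreal ((cmod (f t))\<^sup>2 / 2) \<partial>lborel)"
    by (subst gauss_kernel_minus) (simp add: nn_integral_cmult gauss_kernel_nn_integral[OF \<open>\<epsilon> > 0\<close>])
  also have "(\<integral>\<^sup>+t. ennreal ((cmod (f t))\<^sup>2 / 2) \<partial>lborel) + (\<integral>\<^sup>+t. ennreal ((cmod (f t))\<^sup>2 / 2) \<partial>lborel) = energy f"
    unfolding energy_def by (subst nn_integral_add[symmetric]) (auto simp: ennreal_plus[symmetric] simp del: ennreal_plus)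
  finally show ?thesis .
qed

text \<open>
  The half of Plancherel's theorem that needs no approximation argument: the damped Parseval
  identity with \<open>g = f\<close> bounds the damped energy of the transform uniformly, and
  Fatou's lemma removes the damping. The reverse inequality enters only through inversion.
\<close>

lemma Bessel_fourier_integral:
  assumes f: "integrable lborel f"
  shows "energy (fourier_integral f) \<le> energy f"
proof -
  have [measurable]: "f \<in> borel_measurable borel" using f by auto
  let ?F = "fourier_integral f"
  have damped: "(\<integral>\<^sup>+\<xi>. ennreal ((cmod (?F \<xi>))\<^sup>2 * gauss (\<epsilon> * \<xi>)) \<partial>lborel) \<le> energy f" if "\<epsilon> > 0" for \<epsilon>
  proof -
    have i: "integrable lborel (\<lambda>\<xi>. (cmod (?F \<xi>))\<^sup>2 * gauss (\<epsilon> * \<xi>))"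
    proof (rule Bochner_Integration.integrable_bound)
      show "integrable lborel (\<lambda>\<xi>. (LINT t|lborel. cmod (f t))\<^sup>2 * gauss (0 + \<epsilon> * \<xi>))"
        using that by (intro integrable_mult_right gauss_scaled_integrable) simp
      show "AE \<xi> in lborel. norm ((cmod (?F \<xi>))\<^sup>2 * gauss (\<epsilon> * \<xi>)) \<le> norm ((LINT t|lborel. cmod (f t))\<^sup>2 * gauss (0 + \<epsilon> * \<xi>))"
        by (intro AE_I2) (auto simp: abs_mult intro!: mult_right_mono power_mono norm_fourier_integral_le)
    qed measurable
    have "(\<integral>\<^sup>+\<xi>. ennreal ((cmod (?F \<xi>))\<^sup>2 * gauss (\<epsilon> * \<xi>)) \<partial>lborel) = ennreal (LINT \<xi>|lborel. (cmod (?F \<xi>))\<^sup>2 * gauss (\<epsilon> * \<xi>))"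
      by (rule nn_integral_eq_integral[OF i]) auto
    also have "(LINT \<xi>|lborel. (cmod (?F \<xi>))\<^sup>2 * gauss (\<epsilon> * \<xi>)) = cmod (complex_of_real (LINT \<xi>|lborel. (cmod (?F \<xi>))\<^sup>2 * gauss (\<epsilon> * \<xi>)))"
      by simp
    also have "complex_of_real (LINT \<xi>|lborel. (cmod (?F \<xi>))\<^sup>2 * gauss (\<epsilon> * \<xi>)) = (LINT \<xi>|lborel. ?F \<xi> * cnj (?F \<xi>) * complex_of_real (gauss (\<epsilon> * \<xi>)))"
      by (subst integral_complex_of_real[symmetric], rule Bochner_Integration.integral_cong[OF refl])
         (simp add: complex_norm_square[symmetric])
    also have "\<dots> = (LINT t|lborel. f t * (LINT u|lborel. cnj (f u) * complex_of_real (gauss_kernel \<epsilon> (t - u))))"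
      by (rule fourier_damped_Parseval[OF f f that])
    also have "ennreal (cmod \<dots>) \<le> energy f"
      by (rule smoothing_quadratic_form_le[OF _ that]) measurable
    finally show ?thesis .
  qed
  have "energy ?F = (\<integral>\<^sup>+\<xi>. liminf (\<lambda>n. ennreal ((cmod (?F \<xi>))\<^sup>2 * gauss (inverse (real (Suc n)) * \<xi>))) \<partial>lborel)"
    unfolding energy_def
  proof (intro nn_integral_cong)
    fix \<xi>
    have "(\<lambda>n. (cmod (?F \<xi>))\<^sup>2 * gauss (inverse (real (Suc n)) * \<xi>)) \<longlonglongrightarrow> (cmod (?F \<xi>))\<^sup>2 * 1"
      using gauss_tendsto_1[of \<xi>] by (intro tendsto_mult tendsto_const) (simp add: field_simps)
    then have "(\<lambda>n. ennreal ((cmod (?F \<xi>))\<^sup>2 * gauss (inverse (real (Suc n)) * \<xi>))) \<longlonglongrightarrow> ennreal ((cmod (?F \<xi>))\<^sup>2)"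
      by (intro tendsto_ennrealI) simp
    then show "ennreal ((cmod (?F \<xi>))\<^sup>2) = liminf (\<lambda>n. ennreal ((cmod (?F \<xi>))\<^sup>2 * gauss (inverse (real (Suc n)) * \<xi>)))"
      by (intro lim_imp_Liminf[symmetric]) auto
  qed
  also have "\<dots> \<le> liminf (\<lambda>n. \<integral>\<^sup>+\<xi>. ennreal ((cmod (?F \<xi>))\<^sup>2 * gauss (inverse (real (Suc n)) * \<xi>)) \<partial>lborel)"
    by (rule nn_integral_liminf) measurable
  also have "\<dots> \<le> limsup (\<lambda>n. \<integral>\<^sup>+\<xi>. ennreal ((cmod (?F \<xi>))\<^sup>2 * gauss (inverse (real (Suc n)) * \<xi>)) \<partial>lborel)"
    by (rule Liminf_le_Limsup) simp
  also have "\<dots> \<le> energy f"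
    by (intro Limsup_bounded always_eventually allI damped) simp
  finally show ?thesis .
qed

definition cutoff :: "nat \<Rightarrow> (real \<Rightarrow> complex) \<Rightarrow> real \<Rightarrow> complex" where
  "cutoff N f t = indicator {- real N..real N} t * f t"

lemma cutoff_L2: "f \<in> L2 \<Longrightarrow> cutoff N f \<in> L2"
  unfolding cutoff_def by (rule L2_restrict) auto

lemma L2_restrict_integrable:
  assumes "f \<in> L2"
  shows "integrable lborel (\<lambda>t. indicator {a..b} t * f t)"
  by (rule L2_mult_integrable[OF L2_indicator_interval assms])

lemma cutoff_integrable: "f \<in> L2 \<Longrightarrow> integrable lborel (cutoff N f)"
  unfolding cutoff_def by (rule L2_restrict_integrable)

lemma fourier_integral_L2:
  assumes "integrable lborel f" "f \<in> L2"
  shows "fourier_integral f \<in> L2"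
  using Bessel_fourier_integral[OF assms(1)] assms(2)
  by (auto simp: L2_iff_energy)

lemma cutoff_tail_tendsto_0:
  assumes "f \<in> L2"
  shows "(\<lambda>N. energy (\<lambda>t. cutoff N f t - f t)) \<longlonglongrightarrow> 0"
proof -
  have [measurable]: "f \<in> borel_measurable borel" using assms by (auto simp: L2_def)
  have "(\<lambda>N. \<integral>\<^sup>+t. ennreal ((cmod (cutoff N f t - f t))\<^sup>2) \<partial>lborel) \<longlonglongrightarrow> (\<integral>\<^sup>+t. 0 \<partial>(lborel :: real measure))"
  proof (rule nn_integral_dominated_convergence)
    show "AE t in lborel. (\<lambda>N. ennreal ((cmod (cutoff N f t - f t))\<^sup>2)) \<longlonglongrightarrow> 0"
    proof (intro AE_I2 tendsto_eventually)
      fix t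
      obtain N0 :: nat where "\<bar>t\<bar> \<le> real N0" using real_arch_simple by blast
      then show "eventually (\<lambda>N. ennreal ((cmod (cutoff N f t - f t))\<^sup>2) = 0) sequentially"
        unfolding eventually_sequentially
        by (intro exI[of _ N0]) (auto simp: cutoff_def indicator_def)
    qed
    show "AE t in lborel. ennreal ((cmod (cutoff N f t - f t))\<^sup>2) \<le> ennreal ((cmod (f t))\<^sup>2)" for N
      by (intro AE_I2) (auto simp: cutoff_def indicator_def)
    show "(\<integral>\<^sup>+t. ennreal ((cmod (f t))\<^sup>2) \<partial>lborel) < \<infinity>"
      using assms by (auto simp: L2_iff_energy energy_def)
  qed (auto simp: cutoff_def)
  then show ?thesis by (simp add: energy_def)
qed

lemma energy_cutoff_diff_le:
  assumes "N \<le> m" "N \<le> n"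
  shows "energy (\<lambda>t. cutoff m f t - cutoff n f t) \<le> energy (\<lambda>t. cutoff N f t - f t)"
  using assms by (intro energy_mono) (auto simp: cutoff_def indicator_def)

lemma is_L2_fourier_iff:
  "is_L2_fourier f g \<longleftrightarrow> g \<in> L2 \<and> (\<lambda>N. energy (\<lambda>\<xi>. fourier_integral (cutoff N f) \<xi> - g \<xi>)) \<longlonglongrightarrow> 0"
  unfolding is_L2_fourier_def energy_def cutoff_def[abs_def] ..

text \<open>
  By the energy bound for integrable functions, the transforms of the truncations form a Cauchy
  sequence. Hence the choice operator in \<open>L2_fourier\<close> selects a genuine transform.
\<close>

lemma L2_fourier_exists:
  assumes "f \<in> L2"
  shows "\<exists>g. is_L2_fourier f g"
proof -
  have Cauchy: "\<exists>N. \<forall>m\<ge>N. \<forall>n\<ge>N. energy (\<lambda>\<xi>. fourier_integral (cutoff m f) \<xi> - fourier_integral (cutoff n f) \<xi>) \<le> ennreal \<epsilon>"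
    if "\<epsilon> > 0" for \<epsilon>
  proof -
    have "eventually (\<lambda>N. energy (\<lambda>t. cutoff N f t - f t) < ennreal \<epsilon>) sequentially"
      using that by (intro order_tendstoD[OF cutoff_tail_tendsto_0[OF assms]]) auto
    then obtain N where N: "energy (\<lambda>t. cutoff N f t - f t) < ennreal \<epsilon>"
      by (auto simp: eventually_sequentially)
    have "energy (\<lambda>\<xi>. fourier_integral (cutoff m f) \<xi> - fourier_integral (cutoff n f) \<xi>) \<le> ennreal \<epsilon>"
      if "m \<ge> N" "n \<ge> N" for m n
    proof -
      have "(\<lambda>\<xi>. fourier_integral (cutoff m f) \<xi> - fourier_integral (cutoff n f) \<xi>) =
          fourier_integral (\<lambda>t. cutoff m f t - cutoff n f t)"
        by (intro ext fourier_integral_diff[symmetric] cutoff_integrable assms)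
      then have "energy (\<lambda>\<xi>. fourier_integral (cutoff m f) \<xi> - fourier_integral (cutoff n f) \<xi>) =
          energy (fourier_integral (\<lambda>t. cutoff m f t - cutoff n f t))"
        by simp
      also have "\<dots> \<le> energy (\<lambda>t. cutoff m f t - cutoff n f t)"
        by (intro Bessel_fourier_integral Bochner_Integration.integrable_diff cutoff_integrable assms)
      also have "\<dots> \<le> energy (\<lambda>t. cutoff N f t - f t)"
        using that by (rule energy_cutoff_diff_le)
      finally show ?thesis using N by simp
    qed
    then show ?thesis by blast
  qed
  obtain g where "g \<in> L2" "(\<lambda>N. energy (\<lambda>\<xi>. fourier_integral (cutoff N f) \<xi> - g \<xi>)) \<longlonglongrightarrow> 0"
    using L2_complete[of "\<lambda>N. fourier_integral (cutoff N f)", OF fourier_integral_L2 Cauchy]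
      cutoff_integrable[OF assms] cutoff_L2[OF assms] by blast
  then show ?thesis by (auto simp: is_L2_fourier_iff)
qed

lemma is_L2_fourier_L2_fourier: "f \<in> L2 \<Longrightarrow> is_L2_fourier f (L2_fourier f)"
  unfolding L2_fourier_def using L2_fourier_exists[of f] by (rule someI_ex)

lemma ennreal_le_of_tendsto_0:
  fixes x c :: ennreal
  assumes "\<And>N. x \<le> 2 * a N + c" and "a \<longlonglongrightarrow> 0"
  shows "x \<le> c"
proof (rule tendsto_lowerbound)
  have "(\<lambda>N. 2 * a N + c) \<longlonglongrightarrow> 2 * 0 + c"
    by (intro tendsto_add ennreal_tendsto_cmult assms(2) tendsto_const) auto
  then show "(\<lambda>N. 2 * a N + c) \<longlonglongrightarrow> c" by simp
qed (use assms(1) in auto)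

lemma energy_fourier_le:
  assumes "f \<in> L2" "is_L2_fourier f g"
  shows "energy g \<le> 2 * energy f"
proof (rule ennreal_le_of_tendsto_0)
  have [measurable]: "g \<in> borel_measurable borel" "f \<in> borel_measurable borel"
    using assms by (auto simp: is_L2_fourier_iff L2_def)
  show "(\<lambda>N. energy (\<lambda>\<xi>. fourier_integral (cutoff N f) \<xi> - g \<xi>)) \<longlonglongrightarrow> 0"
    using assms(2) by (simp add: is_L2_fourier_iff)
  fix N
  have [measurable]: "cutoff N f \<in> borel_measurable borel" unfolding cutoff_def by measurable
  have "energy g \<le> 2 * energy (\<lambda>\<xi>. g \<xi> - fourier_integral (cutoff N f) \<xi>) + 2 * energy (fourier_integral (cutoff N f))"
    using energy_add_le[of "\<lambda>\<xi>. g \<xi> - fourier_integral (cutoff N f) \<xi>" "fourier_integral (cutoff N f)"] by simp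
  also have "energy (\<lambda>\<xi>. g \<xi> - fourier_integral (cutoff N f) \<xi>) = energy (\<lambda>\<xi>. fourier_integral (cutoff N f) \<xi> - g \<xi>)"
    by (rule energy_minus_commute)
  also have "energy (fourier_integral (cutoff N f)) \<le> energy f"
    using Bessel_fourier_integral[OF cutoff_integrable[OF assms(1), of N]]
    by (rule order_trans) (auto intro!: energy_mono simp: cutoff_def indicator_def)
  finally show "energy g \<le> 2 * energy (\<lambda>\<xi>. fourier_integral (cutoff N f) \<xi> - g \<xi>) + 2 * energy f"
    by (simp add: add_left_mono mult_left_mono)
qed

section \<open>Inversion and band-limited approximation\<close>

lemma integrable_indicator_interval: "integrable lborel (indicator {a..b} :: real \<Rightarrow> complex)"
  using L2_mult_integrable[OF L2_indicator_interval[of a b] L2_indicator_interval[of a b]]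
  by (simp add: indicator_inter_arith[symmetric])

text \<open>
  Rescaled to a fixed Gaussian, the integrand converges pointwise because \<open>t\<close> is interior or exterior to the
  interval; the endpoints form a null set in the applications.
\<close>

lemma smoothed_indicator_tendsto:
  assumes "t \<noteq> a" "t \<noteq> b"
  shows "(\<lambda>n. LINT u|lborel. indicator {a..b} u * gauss_kernel (inverse (real (Suc n))) (t - u)) \<longlonglongrightarrow> indicator {a..b} t"
proof -
  have eq: "(LINT u|lborel. indicator {a..b} u * gauss_kernel \<epsilon> (t - u)) = (LINT y|lborel. indicator {a..b} (t + (- \<epsilon>) * y) * gauss y)"
    if "\<epsilon> > 0" for \<epsilon>
    using that by (subst lborel_integral_real_affine[of "- \<epsilon>" _ t]) (auto simp: gauss_kernel_def)
  have "(\<lambda>n. LINT y|lborel. indicator {a..b} (t + (- inverse (real (Suc n))) * y) * gauss y) \<longlonglongrightarrow> (LINT y|lborel. indicator {a..b} t * gauss y)"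
  proof (rule integral_dominated_convergence[where w = gauss])
    show "AE y in lborel. (\<lambda>n. indicator {a..b} (t + (- inverse (real (Suc n))) * y) * gauss y) \<longlonglongrightarrow> indicator {a..b} t * gauss y"
    proof (intro AE_I2 tendsto_mult tendsto_const tendsto_eventually)
      fix y :: real
      have "(\<lambda>n. t + (- inverse (real (Suc n))) * y) \<longlonglongrightarrow> t + (- 0) * y"
        by (intro tendsto_intros LIMSEQ_inverse_real_of_nat)
      then have l: "(\<lambda>n. t + (- inverse (real (Suc n))) * y) \<longlonglongrightarrow> t" by simp
      consider "t < a" | "a < t" "t < b" | "b < t" using assms by linarith
      then show "eventually (\<lambda>n. indicator {a..b} (t + (- inverse (real (Suc n))) * y) = (indicator {a..b} t :: real)) sequentially"
      proof cases
        case 1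
        from order_tendstoD(2)[OF l 1] show ?thesis
          by eventually_elim (use 1 in \<open>auto simp: indicator_def\<close>)
      next
        case 2
        from order_tendstoD(1)[OF l 2(1)] order_tendstoD(2)[OF l 2(2)] show ?thesis
          by eventually_elim (use 2 in \<open>auto simp: indicator_def\<close>)
      next
        case 3
        from order_tendstoD(1)[OF l 3] show ?thesis
          by eventually_elim (use 3 in \<open>auto simp: indicator_def\<close>)
      qed
    qed
    show "AE y in lborel. norm (indicator {a..b} (t + (- inverse (real (Suc n))) * y) * gauss y) \<le> gauss y" for n
      by (intro AE_I2) (auto simp: indicator_def)
  qed (auto intro: gauss_integrable)
  then show ?thesis
    by (simp add: eq gauss_integral del: of_nat_Suc)
qed

text \<open>
  Parseval's identity is proved only against indicators of intervals: for these the smoothed function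
  converges by an elementary argument, and they suffice to determine a function almost everywhere.
\<close>

lemma interval_Parseval_integrable:
  assumes f: "integrable lborel f" "f \<in> L2" and "a \<le> b"
  shows "(LINT \<xi>|lborel. fourier_integral f \<xi> * cnj (fourier_integral (indicator {a..b}) \<xi>)) = (LINT t|lborel. indicator {a..b} t * f t)"
proof (rule LIMSEQ_unique)
  have [measurable]: "f \<in> borel_measurable borel" using f by auto
  have Ii: "integrable lborel (indicator {a..b} :: real \<Rightarrow> complex)"
    by (rule integrable_indicator_interval)
  have IL: "(indicator {a..b} :: real \<Rightarrow> complex) \<in> L2" using L2_indicator_interval[of a b] by simp
  let ?\<epsilon> = "\<lambda>n. inverse (real (Suc n))"
  let ?w = "\<lambda>\<xi>. fourier_integral f \<xi> * cnj (fourier_integral (indicator {a..b}) \<xi>)"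
  have w: "integrable lborel ?w"
    by (intro L2_mult_integrable L2_cnj fourier_integral_L2 f Ii IL)
  let ?S = "\<lambda>n. LINT \<xi>|lborel. ?w \<xi> * complex_of_real (gauss (?\<epsilon> n * \<xi>))"
  show "?S \<longlonglongrightarrow> (LINT \<xi>|lborel. ?w \<xi>)"
  proof (rule integral_dominated_convergence[where w = "\<lambda>\<xi>. cmod (?w \<xi>)"])
    show "AE \<xi> in lborel. (\<lambda>n. ?w \<xi> * complex_of_real (gauss (?\<epsilon> n * \<xi>))) \<longlonglongrightarrow> ?w \<xi>"
    proof (intro AE_I2)
      fix \<xi>
      have "(\<lambda>n. ?w \<xi> * complex_of_real (gauss (?\<epsilon> n * \<xi>))) \<longlonglongrightarrow> ?w \<xi> * complex_of_real 1"
        using gauss_tendsto_1[of \<xi>] by (intro tendsto_mult tendsto_const tendsto_of_real) (simp add: field_simps)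
      then show "(\<lambda>n. ?w \<xi> * complex_of_real (gauss (?\<epsilon> n * \<xi>))) \<longlonglongrightarrow> ?w \<xi>" by simp
    qed
    show "AE \<xi> in lborel. norm (?w \<xi> * complex_of_real (gauss (?\<epsilon> n * \<xi>))) \<le> cmod (?w \<xi>)" for n
      by (intro AE_I2) (auto simp: norm_mult gauss_le_1 intro!: mult_right_le_one_le)
  qed (use w in auto)
  let ?T = "\<lambda>n t. f t * complex_of_real (LINT u|lborel. indicator {a..b} u * gauss_kernel (?\<epsilon> n) (t - u))"
  have "?S n = (LINT t|lborel. ?T n t)" for n
  proof -
    have "cnj (indicator {a..b} u) * complex_of_real (gauss_kernel (?\<epsilon> n) (t - u)) = complex_of_real (indicator {a..b} u * gauss_kernel (?\<epsilon> n) (t - u))" for t u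
      by (auto simp: indicator_def)
    then show ?thesis
      by (subst fourier_damped_Parseval[OF f(1) Ii]) (simp_all del: of_real_mult)
  qed
  moreover have "(\<lambda>n. LINT t|lborel. ?T n t) \<longlonglongrightarrow> (LINT t|lborel. indicator {a..b} t * f t)"
  proof (rule integral_dominated_convergence[where w = "\<lambda>t. cmod (f t)"])
    have "AE t in lborel. t \<noteq> a" "AE t in lborel. t \<noteq> b" by (auto intro: AE_lborel_singleton)
    then show "AE t in lborel. (\<lambda>n. ?T n t) \<longlonglongrightarrow> indicator {a..b} t * f t"
    proof eventually_elim
      case (elim t)
      have "(\<lambda>n. ?T n t) \<longlonglongrightarrow> f t * complex_of_real (indicator {a..b} t)"
        by (intro tendsto_mult tendsto_const tendsto_of_real smoothed_indicator_tendsto elim)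
      moreover have "f t * complex_of_real (indicator {a..b} t) = indicator {a..b} t * f t"
        by (simp add: indicator_def)
      ultimately show ?case by (simp only:)
    qed
    show "AE t in lborel. norm (?T n t) \<le> cmod (f t)" for n
    proof (intro AE_I2)
      fix t
      have \<epsilon>: "?\<epsilon> n > 0" by simp
      have "(LINT u|lborel. indicator {a..b} u * gauss_kernel (?\<epsilon> n) (t - u)) \<le> (LINT u|lborel. gauss_kernel (?\<epsilon> n) (t - u))"
        using gauss_kernel_integrable[OF \<epsilon>, of t] gauss_kernel_nonneg[OF \<epsilon>]
        by (intro integral_mono_AE' AE_I2) (auto simp: indicator_def)
      also have "\<dots> = 1" by (rule gauss_kernel_integral[OF \<epsilon>])
      finally have "(LINT u|lborel. indicator {a..b} u * gauss_kernel (?\<epsilon> n) (t - u)) \<le> 1" .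
      moreover have "0 \<le> (LINT u|lborel. indicator {a..b} u * gauss_kernel (?\<epsilon> n) (t - u))"
        using gauss_kernel_nonneg[OF \<epsilon>] by (intro integral_nonneg_AE AE_I2) auto
      ultimately show "norm (?T n t) \<le> cmod (f t)"
        by (simp add: norm_mult mult_right_le_one_le del: of_nat_Suc)
    qed
  qed (use f in auto)
  ultimately show "?S \<longlonglongrightarrow> (LINT t|lborel. indicator {a..b} t * f t)" by simp
qed

lemma interval_Parseval:
  assumes f: "f \<in> L2" and g: "is_L2_fourier f g" and "a \<le> b"
  shows "(LINT \<xi>|lborel. g \<xi> * cnj (fourier_integral (indicator {a..b}) \<xi>)) = (LINT t|lborel. indicator {a..b} t * f t)"
proof (rule LIMSEQ_unique)
  have Ii: "integrable lborel (indicator {a..b} :: real \<Rightarrow> complex)"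
    by (rule integrable_indicator_interval)
  have IL: "(indicator {a..b} :: real \<Rightarrow> complex) \<in> L2" using L2_indicator_interval[of a b] by simp
  let ?S = "\<lambda>N. LINT \<xi>|lborel. fourier_integral (cutoff N f) \<xi> * cnj (fourier_integral (indicator {a..b}) \<xi>)"
  show "?S \<longlonglongrightarrow> (LINT \<xi>|lborel. g \<xi> * cnj (fourier_integral (indicator {a..b}) \<xi>))"
    using g by (intro L2_pairing_tendsto L2_cnj fourier_integral_L2 cutoff_integrable cutoff_L2 f Ii IL) 
      (auto simp: is_L2_fourier_iff)
  have "?S N = (LINT t|lborel. cutoff N f t * indicator {a..b} t)" for N
    by (subst interval_Parseval_integrable[OF cutoff_integrable[OF f] cutoff_L2[OF f] \<open>a \<le> b\<close>]) (simp add: mult.commute)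
  moreover have "(\<lambda>N. LINT t|lborel. cutoff N f t * indicator {a..b} t) \<longlonglongrightarrow> (LINT t|lborel. f t * indicator {a..b} t)"
    by (intro L2_pairing_tendsto cutoff_L2 f IL cutoff_tail_tendsto_0)
  ultimately show "?S \<longlonglongrightarrow> (LINT t|lborel. indicator {a..b} t * f t)"
    by (simp add: mult.commute)
qed

lemma fourier_integral_indicator_reflect:
  "fourier_integral (indicator {- b..- a}) \<xi> = cnj (fourier_integral (indicator {a..b}) \<xi>)"
proof -
  have "cnj (fourier_integral (indicator {a..b}) \<xi>) = (LINT t|lborel. cnj (indicator {a..b} t * cis (- (2 * pi * t * \<xi>))))"
    unfolding fourier_integral_eq_cis by (rule Bochner_Integration.integral_cnj[symmetric])
  also have "\<dots> = (LINT t|lborel. indicator {a..b} t * cis (2 * pi * t * \<xi>))"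
    by (intro Bochner_Integration.integral_cong) (auto simp: cis_cnj indicator_def)
  also have "\<dots> = (LINT t|lborel. indicator {a..b} (0 + (-1) * t) * cis (2 * pi * (0 + (-1) * t) * \<xi>))"
    by (subst lborel_integral_real_affine[of "-1" _ 0]) auto
  also have "\<dots> = fourier_integral (indicator {- b..- a}) \<xi>"
    unfolding fourier_integral_eq_cis
    by (intro Bochner_Integration.integral_cong) (auto simp: indicator_def)
  finally show ?thesis ..
qed

lemma energy_reflect:
  assumes [measurable]: "f \<in> borel_measurable borel"
  shows "energy (\<lambda>t. f (- t)) = energy f"
  unfolding energy_def
  using nn_integral_real_affine[of "\<lambda>t. ennreal ((cmod (f t))\<^sup>2)" "-1" 0] by simp

text \<open>
  Applying the transform twice reflects the line. Both functions are tested on an interval: the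
  multiplication formula carries \<open>h\<close> to \<open>g\<close>, and interval Parseval carries \<open>g\<close> to \<open>f\<close>.
\<close>

lemma fourier_inversion:
  assumes f: "f \<in> L2" and g: "is_L2_fourier f g" and h: "is_L2_fourier g h"
  shows "AE t in lborel. h (- t) = f t"
proof -
  have gL: "g \<in> L2" and hL: "h \<in> L2" using g h by (auto simp: is_L2_fourier_iff)
  have [measurable]: "h \<in> borel_measurable borel" using hL by (simp add: L2_def)
  have h'L: "(\<lambda>t. h (- t)) \<in> L2"
    using hL by (auto simp: L2_iff_energy energy_reflect)
  have "AE t in lborel. f t - h (- t) = 0"
  proof (rule AE_zero_if_interval_integrals_zero[OF L2_diff[OF f h'L]])
    fix a b :: real assume "a \<le> b"
    let ?I = "indicator {- b..- a} :: real \<Rightarrow> complex"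
    have Ii: "integrable lborel ?I"
      by (rule integrable_indicator_interval)
    have IL: "?I \<in> L2" using L2_indicator_interval[of "- b" "- a"] by simp
    have "(LINT t|lborel. h t * ?I t) = (LINT \<xi>|lborel. g \<xi> * fourier_integral ?I \<xi>)"
    proof (rule LIMSEQ_unique)
      let ?S = "\<lambda>N. LINT t|lborel. fourier_integral (cutoff N g) t * ?I t"
      show "?S \<longlonglongrightarrow> (LINT t|lborel. h t * ?I t)"
        using h by (intro L2_pairing_tendsto fourier_integral_L2 cutoff_integrable cutoff_L2 gL IL)
          (auto simp: is_L2_fourier_iff)
      have "(\<lambda>N. LINT \<xi>|lborel. cutoff N g \<xi> * fourier_integral ?I \<xi>) \<longlonglongrightarrow> (LINT \<xi>|lborel. g \<xi> * fourier_integral ?I \<xi>)"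
        by (intro L2_pairing_tendsto cutoff_L2 gL fourier_integral_L2 Ii IL cutoff_tail_tendsto_0)
      then show "?S \<longlonglongrightarrow> (LINT \<xi>|lborel. g \<xi> * fourier_integral ?I \<xi>)"
        by (simp add: fourier_multiplication_formula[OF cutoff_integrable[OF gL] Ii])
    qed
    also have "\<dots> = (LINT t|lborel. indicator {a..b} t * f t)"
      by (simp add: fourier_integral_indicator_reflect interval_Parseval[OF f g \<open>a \<le> b\<close>])
    also have "(LINT t|lborel. h t * ?I t) = (LINT t|lborel. h (0 + (-1) * t) * ?I (0 + (-1) * t))"
      by (subst lborel_integral_real_affine[of "-1" _ 0]) auto
    also have "\<dots> = (LINT t|lborel. indicator {a..b} t * h (- t))"
      by (intro Bochner_Integration.integral_cong) (auto simp: indicator_def)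
    finally have "(LINT t|lborel. indicator {a..b} t * h (- t)) = (LINT t|lborel. indicator {a..b} t * f t)" .
    then show "(LINT t|lborel. indicator {a..b} t * (f t - h (- t))) = 0"
      using L2_restrict_integrable[OF f, of a b] L2_restrict_integrable[OF h'L, of a b]
      by (simp add: right_diff_distrib)
  qed
  then show ?thesis by eventually_elim simp
qed

text \<open>
  The part of \<open>f\<close> with frequencies in \<open>[a, b]\<close> is the inverse transform of the restriction of \<open>g\<close>; by
  inversion the remainder is a limit of inverse transforms of functions supported off
  \<open>[a, b]\<close>, whose energy is controlled on the frequency side.
\<close>

lemma bandlimited_approximation:
  assumes f: "f \<in> L2" and g: "is_L2_fourier f g"
  shows "energy (\<lambda>t. f t - fourier_integral (\<lambda>\<xi>. indicator {a..b} \<xi> * g \<xi>) (- t)) \<le> 2 * energy (\<lambda>\<xi>. indicator (- {a..b}) \<xi> * g \<xi>)"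
proof -
  have gL: "g \<in> L2" using g by (auto simp: is_L2_fourier_iff)
  obtain h where h: "is_L2_fourier g h" using L2_fourier_exists[OF gL] by blast
  then have hL: "h \<in> L2" by (auto simp: is_L2_fourier_iff)
  have [measurable]: "h \<in> borel_measurable borel" "f \<in> borel_measurable borel" "g \<in> borel_measurable borel"
    using hL f gL by (auto simp: L2_def)
  have [measurable]: "cutoff N g \<in> borel_measurable borel" for N unfolding cutoff_def by measurable
  let ?u = "fourier_integral (\<lambda>\<xi>. indicator {a..b} \<xi> * g \<xi>)"
  have "energy (\<lambda>t. f t - ?u (- t)) = energy (\<lambda>t. h (- t) - ?u (- t))"
    unfolding energy_def
    by (rule nn_integral_cong_AE) (use fourier_inversion[OF f g h] in eventually_elim, simp)
  also have "\<dots> = energy (\<lambda>t. h t - ?u t)"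
    by (rule energy_reflect[of "\<lambda>t. h t - ?u t"]) measurable
  also have "\<dots> \<le> 2 * energy (\<lambda>\<xi>. indicator (- {a..b}) \<xi> * g \<xi>)"
  proof (rule tendsto_lowerbound)
    have "(\<lambda>N. 2 * energy (\<lambda>\<xi>. fourier_integral (cutoff N g) \<xi> - h \<xi>) + 2 * energy (\<lambda>\<xi>. indicator (- {a..b}) \<xi> * g \<xi>))
        \<longlonglongrightarrow> 2 * 0 + 2 * energy (\<lambda>\<xi>. indicator (- {a..b}) \<xi> * g \<xi>)"
      using h by (intro tendsto_add ennreal_tendsto_cmult tendsto_const) (auto simp: is_L2_fourier_iff)
    then show "(\<lambda>N. 2 * energy (\<lambda>\<xi>. fourier_integral (cutoff N g) \<xi> - h \<xi>) + 2 * energy (\<lambda>\<xi>. indicator (- {a..b}) \<xi> * g \<xi>))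
        \<longlonglongrightarrow> 2 * energy (\<lambda>\<xi>. indicator (- {a..b}) \<xi> * g \<xi>)" by simp
    obtain N0 :: nat where N0: "max \<bar>a\<bar> \<bar>b\<bar> \<le> real N0" using real_arch_simple by blast
    show "eventually (\<lambda>N. energy (\<lambda>t. h t - ?u t) \<le> 2 * energy (\<lambda>\<xi>. fourier_integral (cutoff N g) \<xi> - h \<xi>) + 2 * energy (\<lambda>\<xi>. indicator (- {a..b}) \<xi> * g \<xi>)) sequentially"
      using eventually_ge_at_top[of N0]
    proof eventually_elim
      case (elim N)
      have "energy (\<lambda>t. h t - ?u t) \<le> 2 * energy (\<lambda>t. h t - fourier_integral (cutoff N g) t) + 2 * energy (\<lambda>t. fourier_integral (cutoff N g) t - ?u t)"
        by (rule energy_triangle) measurable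
      also have "energy (\<lambda>t. h t - fourier_integral (cutoff N g) t) = energy (\<lambda>\<xi>. fourier_integral (cutoff N g) \<xi> - h \<xi>)"
        by (rule energy_minus_commute)
      also have "(\<lambda>t. fourier_integral (cutoff N g) t - ?u t) = fourier_integral (\<lambda>\<xi>. cutoff N g \<xi> - indicator {a..b} \<xi> * g \<xi>)"
        by (intro ext fourier_integral_diff[symmetric] cutoff_integrable L2_restrict_integrable gL)
      also have "energy \<dots> \<le> energy (\<lambda>\<xi>. cutoff N g \<xi> - indicator {a..b} \<xi> * g \<xi>)"
        by (intro Bessel_fourier_integral Bochner_Integration.integrable_diff cutoff_integrable L2_restrict_integrable gL)
      also have "\<dots> \<le> energy (\<lambda>\<xi>. indicator (- {a..b}) \<xi> * g \<xi>)"
        using elim N0 by (intro energy_mono) (auto simp: cutoff_def indicator_def)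
      finally show ?case by (simp add: add_left_mono mult_left_mono)
    qed
  qed simp
  finally show ?thesis .
qed

section \<open>Moments and the p-mean\<close>

text \<open>
  The increments over the two halves of \<open>[u, v]\<close> are compared by the mean value theorem: the derivative is
  strictly increasing. Working with open intervals keeps \<open>u = 0\<close> admissible.
\<close>

lemma midpoint_powr_less:
  fixes u v p :: real
  assumes "0 \<le> u" "u < v" "p > 1"
  shows "((u + v) / 2) powr p < (u powr p + v powr p) / 2"
proof -
  define w where "w = (u + v) / 2"
  have w: "u < w" "w < v" "v - w = w - u" using assms by (auto simp: w_def field_simps)
  have MVT: "\<exists>z. x < z \<and> z < y \<and> y powr p - x powr p = (y - x) * (p * z powr (p - 1))" if "0 \<le> x" "x < y" for x y
  proof -
    have der: "((\<lambda>z. z powr p) has_real_derivative p * z powr (p - 1)) (at z)" if "x < z" for z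
      using that \<open>0 \<le> x\<close> by (auto intro!: derivative_eq_intros)
    have "continuous_on {x..y} (\<lambda>z. z powr p)"
      using that assms by (intro continuous_on_powr') (auto intro!: continuous_intros)
    moreover have "(\<lambda>z. z powr p) differentiable (at z)" if "x < z" for z
      using der[OF that] by (rule differentiableI[OF has_field_derivative_imp_has_derivative])
    ultimately obtain l z where lz: "x < z" "z < y" "((\<lambda>z. z powr p) has_real_derivative l) (at z)" "y powr p - x powr p = (y - x) * l"
      using MVT[OF \<open>x < y\<close>, of "\<lambda>z. z powr p"] by blast
    have "l = p * z powr (p - 1)" by (rule DERIV_unique[OF lz(3) der[OF lz(1)]])
    then show ?thesis using lz by blast
  qed
  obtain z1 where z1: "u < z1" "z1 < w" "w powr p - u powr p = (w - u) * (p * z1 powr (p - 1))"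
    using MVT[of u w] assms w by auto
  obtain z2 where z2: "w < z2" "z2 < v" "v powr p - w powr p = (v - w) * (p * z2 powr (p - 1))"
    using MVT[of w v] assms w by auto
  have "z1 powr (p - 1) < z2 powr (p - 1)"
    using z1 z2 assms by (intro powr_less_mono2) auto
  then have "(w - u) * (p * z1 powr (p - 1)) < (w - u) * (p * z2 powr (p - 1))"
    using w assms by simp
  then have "w powr p - u powr p < v powr p - w powr p"
    by (simp only: z1(3) z2(3) w(3))
  then have "w powr p < (u powr p + v powr p) / 2" by (simp add: field_simps)
  then show ?thesis by (simp only: w_def)
qed

lemma midpoint_abs_powr_less:
  fixes x y p :: real
  assumes "x \<noteq> y" "p > 1"
  shows "\<bar>(x + y) / 2\<bar> powr p < (\<bar>x\<bar> powr p + \<bar>y\<bar> powr p) / 2"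
proof (cases "\<bar>x\<bar> = \<bar>y\<bar>")
  case True
  then have "x = - y" "y \<noteq> 0" using assms by (auto simp: abs_if split: if_splits)
  then show ?thesis using assms by simp
next
  case False
  have "\<bar>(x + y) / 2\<bar> powr p \<le> ((\<bar>x\<bar> + \<bar>y\<bar>) / 2) powr p"
    using assms by (intro powr_mono2) auto
  also have "\<dots> < (\<bar>x\<bar> powr p + \<bar>y\<bar> powr p) / 2"
    using False midpoint_powr_less[of "\<bar>x\<bar>" "\<bar>y\<bar>" p] midpoint_powr_less[of "\<bar>y\<bar>" "\<bar>x\<bar>" p] assms
    by (cases "\<bar>x\<bar> < \<bar>y\<bar>") (auto simp: add.commute)
  finally show ?thesis .
qed

lemma abs_add_powr_le:
  fixes x y p :: real
  assumes "p > 0"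
  shows "\<bar>x + y\<bar> powr p \<le> 2 powr p * (\<bar>x\<bar> powr p + \<bar>y\<bar> powr p)"
proof -
  have "\<bar>x + y\<bar> powr p \<le> (2 * max \<bar>x\<bar> \<bar>y\<bar>) powr p"
    using assms by (intro powr_mono2) auto
  also have "\<dots> = 2 powr p * max \<bar>x\<bar> \<bar>y\<bar> powr p"
    by (simp add: powr_mult)
  also have "\<dots> \<le> 2 powr p * (\<bar>x\<bar> powr p + \<bar>y\<bar> powr p)"
    by (intro mult_left_mono) (auto simp: max_def)
  finally show ?thesis .
qed

definition moment :: "real \<Rightarrow> (real \<Rightarrow> complex) \<Rightarrow> real \<Rightarrow> ennreal" where
  "moment p h a = (\<integral>\<^sup>+t. ennreal (\<bar>t - a\<bar> powr p * (cmod (h t))\<^sup>2) \<partial>lborel)"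

lemma spread_eq: "spread p h a = ennpowr (moment p h a) (1 / 2)"
  by (simp add: spread_def moment_def)

lemma spread_le_iff: "spread p h a \<le> spread p h b \<longleftrightarrow> moment p h a \<le> moment p h b"
proof -
  have "ennpowr x (1/2) \<le> ennpowr y (1/2) \<longleftrightarrow> x \<le> y" for x y
    by (cases x; cases y) (auto simp: ennpowr_def top_unique powr_half_sqrt ennreal_le_iff)
  then show ?thesis by (simp add: spread_eq)
qed

lemma spread_le_imp_moment_le:
  assumes "spread p h a \<le> ennreal A" "A \<ge> 0"
  shows "moment p h a \<le> ennreal (A\<^sup>2)"
proof (cases "moment p h a")
  case (real m)
  then have "sqrt m \<le> A" using assms by (simp add: spread_eq ennpowr_def powr_half_sqrt)
  then have "m \<le> A\<^sup>2" using real by (simp add: real_sqrt_le_iff' sqrt_le_D)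
  then show ?thesis using real by (simp add: ennreal_leI)
next
  case top
  then show ?thesis using assms by (simp add: spread_eq ennpowr_def top_unique)
qed

text \<open>
  Chebyshev's inequality for the distribution with density \<open>|h|\<^sup>2\<close>.
\<close>

lemma energy_tail_le:
  assumes [measurable]: "h \<in> borel_measurable borel" and m: "moment p h a \<le> ennreal (A\<^sup>2)" and "W > 0" "p > 0"
  shows "energy (\<lambda>t. indicator (- {a - W..a + W}) t * h t) \<le> ennreal (A\<^sup>2 / W powr p)"
proof -
  have "ennreal (W powr p) * energy (\<lambda>t. indicator (- {a - W..a + W}) t * h t) = (\<integral>\<^sup>+t. ennreal (W powr p) * ennreal ((cmod (indicator (- {a - W..a + W}) t * h t))\<^sup>2) \<partial>lborel)"
    unfolding energy_def by (simp add: nn_integral_cmult)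
  also have "\<dots> \<le> moment p h a"
    unfolding moment_def
  proof (intro nn_integral_mono)
    fix t
    show "ennreal (W powr p) * ennreal ((cmod (indicator (- {a - W..a + W}) t * h t))\<^sup>2) \<le> ennreal (\<bar>t - a\<bar> powr p * (cmod (h t))\<^sup>2)"
    proof (cases "t \<in> {a - W..a + W}")
      case False
      then have "W \<le> \<bar>t - a\<bar>" by auto
      then have "W powr p \<le> \<bar>t - a\<bar> powr p" using assms by (intro powr_mono2) auto
      then show ?thesis using False
        by (simp add: ennreal_mult[symmetric] ennreal_leI mult_right_mono)
    qed simp
  qed
  also note m
  finally have "ennreal (1 / W powr p) * (ennreal (W powr p) * energy (\<lambda>t. indicator (- {a - W..a + W}) t * h t)) \<le> ennreal (1 / W powr p) * ennreal (A\<^sup>2)"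
    by (intro mult_left_mono) auto
  then show ?thesis using \<open>W > 0\<close>
    by (simp add: mult.assoc[symmetric] ennreal_mult[symmetric])
qed

text \<open>
  This is what makes a bound on the \<open>p\<close>-mean informative: \<open>p_mean\<close> is a definite description, so
  existence and uniqueness of the minimizer have to be established. The \<open>p\<close>-th moment is finite
  everywhere once it is finite somewhere, continuous in the centre by dominated convergence, and
  coercive because \<open>|a - a0|\<^sup>p\<close> is at most a constant times the sum of the moments about \<open>a\<close> and \<open>a0\<close>.
  So a minimizer exists. Strict convexity of \<open>|x|\<^sup>p\<close> for \<open>p > 1\<close> makes it unique.
\<close>

lemma spread_p_mean:
  assumes h: "h \<in> L2" "L2_norm h = 1" and p: "p > 1" and fin: "dispersion p h < \<infinity>"
  shows "spread p h (p_mean p h) = dispersion p h"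
proof -
  have [measurable]: "h \<in> borel_measurable borel" using h by (simp add: L2_def)
  have hi: "integrable lborel (\<lambda>t. (cmod (h t))\<^sup>2)" using h by (simp add: L2_def)
  have h1: "(LINT t|lborel. (cmod (h t))\<^sup>2) = 1" using h(2) by (simp add: L2_norm_def)
  let ?w = "\<lambda>a t. \<bar>t - a\<bar> powr p * (cmod (h t))\<^sup>2"
  obtain a0 where a0: "moment p h a0 < \<infinity>"
    using fin unfolding dispersion_def INF_less_iff
    by (auto simp: spread_eq ennpowr_def less_top split: if_splits)
  have i0: "integrable lborel (?w a0)"
    using a0 by (auto simp: integrable_iff_bounded moment_def abs_mult)
  have dom: "?w a t \<le> 2 powr p * (?w a0 t + \<bar>a0 - a\<bar> powr p * (cmod (h t))\<^sup>2)" for a t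
    using mult_right_mono[OF abs_add_powr_le[of p "t - a0" "a0 - a"], of "(cmod (h t))\<^sup>2"] p
    by (simp add: algebra_simps)
  have i: "integrable lborel (?w a)" for a
  proof (rule Bochner_Integration.integrable_bound)
    show "integrable lborel (\<lambda>t. 2 powr p * (?w a0 t + \<bar>a0 - a\<bar> powr p * (cmod (h t))\<^sup>2))"
      using i0 hi by simp
    show "AE t in lborel. norm (?w a t) \<le> norm (2 powr p * (?w a0 t + \<bar>a0 - a\<bar> powr p * (cmod (h t))\<^sup>2))"
    proof (intro AE_I2)
      fix t
      have "0 \<le> ?w a t" by simp
      with dom[of t a] show "norm (?w a t) \<le> norm (2 powr p * (?w a0 t + \<bar>a0 - a\<bar> powr p * (cmod (h t))\<^sup>2))"
        unfolding real_norm_def by linarith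
    qed
  qed measurable
  define \<Phi> where "\<Phi> a = (LINT t|lborel. ?w a t)" for a
  have \<Phi>_nonneg: "\<Phi> a \<ge> 0" for a unfolding \<Phi>_def by simp
  have moment: "moment p h a = ennreal (\<Phi> a)" for a
    unfolding moment_def \<Phi>_def by (intro nn_integral_eq_integral i) auto
  have le_iff: "spread p h a \<le> spread p h b \<longleftrightarrow> \<Phi> a \<le> \<Phi> b" for a b
    by (simp add: spread_le_iff moment \<Phi>_nonneg)
  \<comment> \<open>The midpoint inequality is strict at every \<open>t\<close>, and \<open>h\<close> does not vanish almost everywhere.\<close>
  have strict: "\<Phi> ((a + b) / 2) < (\<Phi> a + \<Phi> b) / 2" if "a \<noteq> b" for a b
  proof -
    let ?D = "\<lambda>t. (?w a t + ?w b t) / 2 - ?w ((a + b) / 2) t"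
    have D: "?D t \<ge> 0" "?D t = 0 \<Longrightarrow> (cmod (h t))\<^sup>2 = 0" for t
    proof -
      have "t - (a + b) / 2 = ((t - a) + (t - b)) / 2" by (simp add: field_simps)
      then have lt: "\<bar>t - (a + b) / 2\<bar> powr p < (\<bar>t - a\<bar> powr p + \<bar>t - b\<bar> powr p) / 2"
        using midpoint_abs_powr_less[of "t - a" "t - b" p] that p by (simp only:)
      have eq: "?D t = ((\<bar>t - a\<bar> powr p + \<bar>t - b\<bar> powr p) / 2 - \<bar>t - (a + b) / 2\<bar> powr p) * (cmod (h t))\<^sup>2"
        by (simp add: field_simps)
      show "?D t \<ge> 0" unfolding eq using lt by (intro mult_nonneg_nonneg) auto
      show "(cmod (h t))\<^sup>2 = 0" if "?D t = 0" using that lt unfolding eq by simp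
    qed
    have Di: "integrable lborel ?D" using i by simp
    have "(LINT t|lborel. ?D t) \<noteq> 0"
    proof
      assume "(LINT t|lborel. ?D t) = 0"
      then have "AE t in lborel. ?D t = 0"
        using integral_nonneg_eq_0_iff_AE[OF Di] D(1) by simp
      then have "AE t in lborel. (cmod (h t))\<^sup>2 = 0"
        by eventually_elim (rule D(2))
      then have "(LINT t|lborel. (cmod (h t))\<^sup>2) = 0"
        by (rule integral_eq_zero_AE)
      then show False using h1 by simp
    qed
    moreover have "(LINT t|lborel. ?D t) \<ge> 0" using D(1) by (intro integral_nonneg_AE AE_I2)
    moreover have "(LINT t|lborel. ?D t) = (\<Phi> a + \<Phi> b) / 2 - \<Phi> ((a + b) / 2)"
      unfolding \<Phi>_def using i by simp
    ultimately show ?thesis by simp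
  qed
  have coercive: "\<bar>a - a0\<bar> powr p \<le> 2 powr p * (\<Phi> a + \<Phi> a0)" for a
  proof -
    have "\<bar>a - a0\<bar> powr p = (LINT t|lborel. \<bar>a - a0\<bar> powr p * (cmod (h t))\<^sup>2)"
      using h1 by simp
    also have "\<dots> \<le> (LINT t|lborel. 2 powr p * (?w a t + ?w a0 t))"
    proof (intro integral_mono)
      fix t
      have "\<bar>(a - t) + (t - a0)\<bar> powr p \<le> 2 powr p * (\<bar>a - t\<bar> powr p + \<bar>t - a0\<bar> powr p)"
        using p by (intro abs_add_powr_le) simp
      then have "\<bar>a - a0\<bar> powr p \<le> 2 powr p * (\<bar>t - a\<bar> powr p + \<bar>t - a0\<bar> powr p)"
        by (simp add: abs_minus_commute[of a t])
      from mult_right_mono[OF this, of "(cmod (h t))\<^sup>2"]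
      show "\<bar>a - a0\<bar> powr p * (cmod (h t))\<^sup>2 \<le> 2 powr p * (?w a t + ?w a0 t)"
        by (simp add: algebra_simps)
    qed (use i hi in auto)
    also have "\<dots> = 2 powr p * (\<Phi> a + \<Phi> a0)" unfolding \<Phi>_def using i by simp
    finally show ?thesis .
  qed
  have cont: "continuous_on UNIV \<Phi>"
    unfolding continuous_on_sequentially
  proof (intro ballI allI impI)
    fix x :: "nat \<Rightarrow> real" and a
    assume "a \<in> UNIV" and asm: "(\<forall>n. x n \<in> UNIV) \<and> x \<longlonglongrightarrow> a"
    then have x: "x \<longlonglongrightarrow> a" by simp
    then obtain K where K: "\<And>n. \<bar>x n\<bar> \<le> K"
      using convergent_imp_Bseq[of x] by (auto simp: convergent_def Bseq_def)
    let ?b = "\<lambda>t. 2 powr p * (?w a0 t + (\<bar>a0\<bar> + K) powr p * (cmod (h t))\<^sup>2)"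
    have "(\<lambda>n. LINT t|lborel. ?w (x n) t) \<longlonglongrightarrow> (LINT t|lborel. ?w a t)"
    proof (rule integral_dominated_convergence[where w = ?b])
      show "AE t in lborel. (\<lambda>n. ?w (x n) t) \<longlonglongrightarrow> ?w a t"
        using p by (intro AE_I2 tendsto_mult tendsto_const tendsto_powr' tendsto_rabs tendsto_diff x) auto
      show "AE t in lborel. norm (?w (x n) t) \<le> ?b t" for n
      proof (intro AE_I2)
        fix t
        have "\<bar>a0 - x n\<bar> powr p \<le> (\<bar>a0\<bar> + K) powr p"
          using p K[of n] by (intro powr_mono2) auto
        from mult_right_mono[OF this, of "(cmod (h t))\<^sup>2"]
        have "2 powr p * (?w a0 t + \<bar>a0 - x n\<bar> powr p * (cmod (h t))\<^sup>2) \<le> ?b t"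
          by (intro mult_left_mono) auto
        from order_trans[OF dom[of t "x n"] this] show "norm (?w (x n) t) \<le> ?b t" by (simp add: abs_mult)
      qed
    qed (use i0 hi in auto)
    then show "(\<Phi> \<circ> x) \<longlonglongrightarrow> \<Phi> a" by (simp add: \<Phi>_def o_def)
  qed
  define R where "R = (2 powr p * (2 * \<Phi> a0)) powr (1 / p)"
  have inR: "\<bar>a - a0\<bar> \<le> R" if "\<Phi> a \<le> \<Phi> a0" for a
  proof -
    have "\<bar>a - a0\<bar> powr p \<le> 2 powr p * (2 * \<Phi> a0)"
      using coercive[of a] that by (intro order_trans[OF coercive]) auto
    then have "(\<bar>a - a0\<bar> powr p) powr (1 / p) \<le> R"
      unfolding R_def using p by (intro powr_mono2) auto
    then show ?thesis using p by (simp add: powr_powr)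
  qed
  have "R \<ge> 0" by (simp add: R_def)
  obtain \<mu> where \<mu>: "\<And>a. a \<in> cball a0 R \<Longrightarrow> \<Phi> \<mu> \<le> \<Phi> a"
  proof -
    have "\<exists>x\<in>cball a0 R. \<forall>y\<in>cball a0 R. \<Phi> x \<le> \<Phi> y"
      using \<open>R \<ge> 0\<close> by (intro continuous_attains_inf continuous_on_subset[OF cont]) auto
    then show ?thesis using that by blast
  qed
  have min: "\<Phi> \<mu> \<le> \<Phi> a" for a
  proof (cases "\<Phi> a \<le> \<Phi> a0")
    case True
    then show ?thesis using inR[OF True] by (intro \<mu>) (simp add: dist_real_def abs_minus_commute)
  next
    case False
    then show ?thesis using \<mu>[of a0] \<open>R \<ge> 0\<close> by simp
  qed
  have disp: "dispersion p h = spread p h \<mu>"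
    unfolding dispersion_def
    by (intro antisym INF_lower INF_greatest) (auto simp: le_iff min)
  have uniq: "a = \<mu>" if "spread p h a = dispersion p h" for a
  proof (rule ccontr)
    assume "a \<noteq> \<mu>"
    have "\<Phi> a \<le> \<Phi> \<mu>" using that le_iff[of a \<mu>] disp by simp
    moreover have "\<Phi> ((a + \<mu>) / 2) * 2 < \<Phi> a + \<Phi> \<mu>"
      using strict[OF \<open>a \<noteq> \<mu>\<close>] by (simp only: pos_less_divide_eq[OF zero_less_numeral])
    moreover note min[of "(a + \<mu>) / 2"]
    ultimately show False by linarith
  qed
  have "p_mean p h = \<mu>"
    unfolding p_mean_def using disp uniq by (intro the_equality) auto
  then show ?thesis using disp by simp
qed

section \<open>Detecting localized functions with finitely many step functions\<close>

lemma norm_cis_diff_le: "cmod (cis x - cis y) \<le> \<bar>x - y\<bar>"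
proof -
  have "cis x - cis y = cis y * (cis (x - y) - 1)"
    by (simp add: right_diff_distrib cis_mult)
  moreover have "cmod (cis (x - y) - 1) \<le> \<bar>x - y\<bar>"
    using iexp_approx1[of "x - y" 0] by (simp add: cis_conv_exp)
  ultimately show ?thesis by (simp add: norm_mult)
qed

lemma L2_integral_le:
  assumes "f \<in> L2" "energy f \<le> ennreal c" "c \<ge> 0"
  shows "(LINT t|lborel. (cmod (f t))\<^sup>2) \<le> c"
  using assms by (simp add: energy_eq_integral)

text \<open>
  Cauchy-Schwarz against the indicator of the interval.
\<close>

lemma L2_integral_interval_le:
  assumes g: "g \<in> L2" and e: "energy g \<le> ennreal c" and "c \<ge> 0" "a \<le> b"
  shows "(LINT \<xi>|lborel. cmod (indicator {a..b} \<xi> * g \<xi>)) \<le> sqrt ((b - a) * c)"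
proof -
  let ?I = "LINT \<xi>|lborel. cmod (indicator {a..b} \<xi> * g \<xi>)"
  have "ennreal ?I = (\<integral>\<^sup>+\<xi>. ennreal (cmod (indicator {a..b} \<xi> * g \<xi>)) \<partial>lborel)"
    using L2_restrict_integrable[OF g, of a b] by (intro nn_integral_eq_integral[symmetric]) auto
  then have "ennreal (?I\<^sup>2) = (\<integral>\<^sup>+\<xi>. ennreal (cmod (indicator {a..b} \<xi>) * cmod (g \<xi>)) \<partial>lborel)\<^sup>2"
    by (simp add: norm_mult ennreal_power[symmetric])
  also have "\<dots> \<le> energy (\<lambda>\<xi>. indicator {a..b} \<xi>) * energy g"
    by (rule nn_integral_Cauchy_Schwarz[OF L2_indicator_interval g])
  also have "energy (\<lambda>\<xi>. indicator {a..b} \<xi>) = (\<integral>\<^sup>+\<xi>. indicator {a..b} \<xi> \<partial>lborel)"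
    unfolding energy_def by (intro nn_integral_cong) (auto simp: indicator_def)
  also have "\<dots> = ennreal (b - a)" using \<open>a \<le> b\<close> by (simp add: emeasure_lborel_Icc_eq)
  also have "ennreal (b - a) * energy g \<le> ennreal (b - a) * ennreal c"
    by (intro mult_left_mono e) auto
  also have "\<dots> = ennreal ((b - a) * c)" using assms by (simp add: ennreal_mult)
  finally have "?I\<^sup>2 \<le> (b - a) * c" using assms by simp
  then show ?thesis by (rule real_le_rsqrt)
qed

text \<open>
  A function with frequencies in \<open>[b - W, b + W]\<close> is bounded, and after demodulation by a frequency
  \<open>k\<close> near \<open>b\<close> its remaining frequencies are at most \<open>W + 1\<close>, so it is Lipschitz with constants that
  do not depend on \<open>b\<close>.
\<close>

lemma
  assumes g: "g \<in> L2" and e: "energy g \<le> ennreal 2" and W: "W > 0" and bk: "\<bar>b - k\<bar> \<le> 1"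
  defines "w \<equiv> (\<lambda>t. fourier_integral (\<lambda>\<xi>. indicator {b - W..b + W} \<xi> * g \<xi>) (- t) * cis (- (2 * pi * k * t)))"
  shows low_pass_bound: "cmod (w t) \<le> 2 * sqrt W"
    and low_pass_Lipschitz: "cmod (w t - w t') \<le> 4 * pi * (W + 1) * sqrt W * \<bar>t - t'\<bar>"
proof -
  let ?g = "\<lambda>\<xi>. indicator {b - W..b + W} \<xi> * g \<xi>"
  let ?N = "LINT \<xi>|lborel. cmod (?g \<xi>)"
  have gi: "integrable lborel ?g" by (rule L2_restrict_integrable[OF g])
  have "?N \<le> sqrt ((b + W - (b - W)) * 2)"
    using W by (intro L2_integral_interval_le g e) auto
  also have "(b + W - (b - W)) * 2 = 2\<^sup>2 * W" by simp
  also have "sqrt \<dots> = 2 * sqrt W" by (simp add: real_sqrt_mult)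
  finally have N: "?N \<le> 2 * sqrt W" .
  show "cmod (w t) \<le> 2 * sqrt W"
    using order_trans[OF norm_fourier_integral_le N, of "- t"] by (simp add: w_def norm_mult)
  have w_eq: "w t = (LINT \<xi>|lborel. ?g \<xi> * cis (2 * pi * t * (\<xi> - k)))" for t
  proof -
    have "w t = (LINT \<xi>|lborel. ?g \<xi> * cis (- (2 * pi * \<xi> * (- t))) * cis (- (2 * pi * k * t)))"
      unfolding w_def fourier_integral_eq_cis by (rule integral_mult_left_zero[symmetric])
    also have "\<dots> = (LINT \<xi>|lborel. ?g \<xi> * cis (2 * pi * t * (\<xi> - k)))"
      by (intro Bochner_Integration.integral_cong refl) (simp add: mult.assoc cis_mult algebra_simps)
    finally show ?thesis .
  qed
  have diff: "w t - w t' = (LINT \<xi>|lborel. ?g \<xi> * (cis (2 * pi * t * (\<xi> - k)) - cis (2 * pi * t' * (\<xi> - k))))"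
    unfolding w_eq using integrable_mult_cis[OF gi, of "\<lambda>\<xi>. 2 * pi * t * (\<xi> - k)"] integrable_mult_cis[OF gi, of "\<lambda>\<xi>. 2 * pi * t' * (\<xi> - k)"]
    by (simp add: right_diff_distrib)
  have "cmod (w t - w t') \<le> (LINT \<xi>|lborel. cmod (?g \<xi> * (cis (2 * pi * t * (\<xi> - k)) - cis (2 * pi * t' * (\<xi> - k)))))"
    unfolding diff by (rule integral_norm_bound)
  also have "\<dots> \<le> (LINT \<xi>|lborel. cmod (?g \<xi>) * (2 * pi * (W + 1) * \<bar>t - t'\<bar>))"
  proof (rule integral_mono_AE')
    show "AE \<xi> in lborel. cmod (?g \<xi> * (cis (2 * pi * t * (\<xi> - k)) - cis (2 * pi * t' * (\<xi> - k)))) \<le> cmod (?g \<xi>) * (2 * pi * (W + 1) * \<bar>t - t'\<bar>)"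
    proof (intro AE_I2)
      fix \<xi>
      show "cmod (?g \<xi> * (cis (2 * pi * t * (\<xi> - k)) - cis (2 * pi * t' * (\<xi> - k)))) \<le> cmod (?g \<xi>) * (2 * pi * (W + 1) * \<bar>t - t'\<bar>)"
      proof (cases "\<xi> \<in> {b - W..b + W}")
        case True
        have "cmod (cis (2 * pi * t * (\<xi> - k)) - cis (2 * pi * t' * (\<xi> - k))) \<le> \<bar>2 * pi * t * (\<xi> - k) - 2 * pi * t' * (\<xi> - k)\<bar>"
          by (rule norm_cis_diff_le)
        also have "2 * pi * t * (\<xi> - k) - 2 * pi * t' * (\<xi> - k) = 2 * pi * (\<xi> - k) * (t - t')" by (simp add: algebra_simps)
        also have "\<bar>\<dots>\<bar> = 2 * pi * \<bar>\<xi> - k\<bar> * \<bar>t - t'\<bar>" by (simp add: abs_mult)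
        also have "\<dots> \<le> 2 * pi * (W + 1) * \<bar>t - t'\<bar>"
          using True bk by (intro mult_right_mono mult_left_mono) auto
        finally show ?thesis unfolding norm_mult by (rule mult_left_mono) simp
      qed simp
    qed
    show "integrable lborel (\<lambda>\<xi>. cmod (?g \<xi>) * (2 * pi * (W + 1) * \<bar>t - t'\<bar>))"
      using gi by (intro integrable_mult_left) simp
  qed (use W in auto)
  also have "\<dots> = ?N * (2 * pi * (W + 1) * \<bar>t - t'\<bar>)" by simp
  also have "\<dots> \<le> (2 * sqrt W) * (2 * pi * (W + 1) * \<bar>t - t'\<bar>)"
    using N W by (intro mult_right_mono) auto
  finally show "cmod (w t - w t') \<le> 4 * pi * (W + 1) * sqrt W * \<bar>t - t'\<bar>"
    by (simp add: mult_ac)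
qed

text \<open>
  The \<open>j\<close>-th cell of a partition of the time axis from \<open>- T\<close> on into intervals of length \<open>\<delta>\<close>, modulated to frequency \<open>k\<close>.
  Half-open intervals keep the cells disjoint, so that a combination of cells is a step function.
\<close>

definition cell :: "real \<Rightarrow> real \<Rightarrow> nat \<Rightarrow> real \<Rightarrow> real \<Rightarrow> complex" where
  "cell T \<delta> j k t = indicator {- T + real j * \<delta>..<- T + real (Suc j) * \<delta>} t * cis (2 * pi * k * t)"

lemma cell_measurable [measurable]: "cell T \<delta> j k \<in> borel_measurable borel"
  unfolding cell_def[abs_def] by measurable

lemma energy_cell: "\<delta> \<ge> 0 \<Longrightarrow> energy (cell T \<delta> j k) = ennreal \<delta>"
proof -
  assume "\<delta> \<ge> 0"
  have "energy (cell T \<delta> j k) = (\<integral>\<^sup>+t. indicator {- T + real j * \<delta>..<- T + real (Suc j) * \<delta>} t \<partial>lborel)"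
    unfolding energy_def by (intro nn_integral_cong) (auto simp: cell_def norm_mult indicator_def)
  also have "\<dots> = ennreal \<delta>" using \<open>\<delta> \<ge> 0\<close> by (simp add: algebra_simps)
  finally show ?thesis .
qed

lemma cell_L2: "\<delta> \<ge> 0 \<Longrightarrow> cell T \<delta> j k \<in> L2"
  by (simp add: L2_iff_energy energy_cell)

lemma L2_norm_cell: "\<delta> \<ge> 0 \<Longrightarrow> L2_norm (cell T \<delta> j k) = sqrt \<delta>"
  using energy_eq_L2_norm[OF cell_L2, of \<delta> T j k] energy_cell[of \<delta> T j k]
  by (simp add: L2_norm_def)

lemma cell_sum:
  fixes c :: "nat \<Rightarrow> complex"
  assumes "\<delta> > 0" "- T \<le> t" "t < - T + real J * \<delta>"
  obtains j where "j < J" "- T + real j * \<delta> \<le> t" "t < - T + real (Suc j) * \<delta>"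
    "(\<Sum>i<J. c i * cell T \<delta> i k t) = c j * cis (2 * pi * k * t)"
proof -
  define j where "j = nat \<lfloor>(t + T) / \<delta>\<rfloor>"
  have f: "real j \<le> (t + T) / \<delta>" "(t + T) / \<delta> < real j + 1"
    using assms unfolding j_def by (auto simp: of_nat_nat)
  have j1: "- T + real j * \<delta> \<le> t" "t < - T + real (Suc j) * \<delta>"
    using f assms by (auto simp: field_simps)
  have "real j < real J"
  proof -
    have "real j * \<delta> < real J * \<delta>" using j1 assms by linarith
    then show ?thesis using assms by simp
  qed
  then have j2: "j < J" by simp
  have z: "cell T \<delta> i k t = 0" if "i \<noteq> j" for i
  proof (cases "i < j")
    case True
    then have "real (Suc i) * \<delta> \<le> real j * \<delta>" using assms by (intro mult_right_mono) auto
    then show ?thesis using j1 by (auto simp: cell_def indicator_def)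
  next
    case False
    then have "real (Suc j) * \<delta> \<le> real i * \<delta>" using assms that by (intro mult_right_mono) auto
    then show ?thesis using j1 by (auto simp: cell_def indicator_def)
  qed
  have "(\<Sum>i<J. c i * cell T \<delta> i k t) = (\<Sum>i\<in>{j}. c i * cell T \<delta> i k t)"
    using j2 z by (intro sum.mono_neutral_right) auto
  also have "\<dots> = c j * cis (2 * pi * k * t)" using j1 by (simp add: cell_def)
  finally show ?thesis using that j1 j2 by blast
qed

lemma real_part_mult_cnj_ge:
  "(cmod z)\<^sup>2 - (cmod (z - s))\<^sup>2 \<le> 2 * Re (s * cnj z)"
proof -
  have "(cmod (z - s))\<^sup>2 = (cmod z)\<^sup>2 + (cmod s)\<^sup>2 - 2 * Re (s * cnj z)"
    by (simp add: cmod_power2) (simp add: power2_eq_square algebra_simps)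
  then show ?thesis by simp
qed

text \<open>
  A quantitative form of compactness, uniform in the frequency \<open>k\<close>. By the frequency hypothesis \<open>h\<close> is
  close to its low-pass part \<open>u\<close>; by the Lipschitz bound \<open>u\<close> is close on \<open>[-T, T)\<close> to a
  combination \<open>P\<close> of the \<open>J\<close> cells; by the time hypothesis almost all of \<open>h\<close> lives there. Hence
  the inner product of \<open>h\<close> with \<open>P\<close> is bounded below, and therefore also that with at least one cell.
\<close>

lemma cell_detection:
  assumes h: "h \<in> L2" "L2_norm h = 1" and g: "is_L2_fourier h g"
    and W: "W > 0" and bk: "\<bar>b - k\<bar> \<le> 1"
    and freq: "energy (\<lambda>\<xi>. indicator (- {b - W..b + W}) \<xi> * g \<xi>) \<le> ennreal (1 / 32)"
    and time: "energy (\<lambda>t. indicator (- {- T..<T}) t * h t) \<le> ennreal (1 / 16)"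
    and T: "T > 0" and J: "J > 0" and \<delta>: "real J * \<delta> = 2 * T"
    and fine: "32 * T * (4 * pi * (W + 1) * sqrt W * \<delta>)\<^sup>2 \<le> 1"
  shows "\<exists>j<J. 1 / (8 * real J * sqrt W) \<le> cmod (L2_inner (cell T \<delta> j k) h)"
proof (rule ccontr)
  assume "\<not> ?thesis"
  then have small: "cmod (L2_inner (cell T \<delta> j k) h) < 1 / (8 * real J * sqrt W)" if "j < J" for j
    using that by force
  have "\<delta> > 0" using T J \<delta> by (metis of_nat_0_less_iff zero_less_mult_pos zero_less_mult_iff zero_less_numeral)
  have gL: "g \<in> L2" using g by (simp add: is_L2_fourier_iff)
  have [measurable]: "h \<in> borel_measurable borel" "g \<in> borel_measurable borel"
    using h gL by (auto simp: L2_def)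
  have eh: "energy h = 1" using energy_eq_L2_norm[OF h(1)] h(2) by simp
  have "energy g \<le> 2 * energy h" by (rule energy_fourier_le[OF h(1) g])
  then have eg: "energy g \<le> ennreal 2" by (simp add: eh)
  define u where "u t = fourier_integral (\<lambda>\<xi>. indicator {b - W..b + W} \<xi> * g \<xi>) (- t)" for t
  define w where "w t = u t * cis (- (2 * pi * k * t))" for t
  let ?L = "4 * pi * (W + 1) * sqrt W"
  have w_le: "cmod (w t) \<le> 2 * sqrt W" for t
    unfolding w_def u_def by (rule low_pass_bound[OF gL eg W bk])
  have w_Lip: "cmod (w t - w t') \<le> ?L * \<bar>t - t'\<bar>" for t t'
    unfolding w_def u_def by (rule low_pass_Lipschitz[OF gL eg W bk])
  have u_eq: "u t = w t * cis (2 * pi * k * t)" for t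
    by (simp add: w_def mult.assoc cis_mult)
  have [measurable]: "u \<in> borel_measurable borel" unfolding u_def by measurable
  have "energy (\<lambda>t. h t - u t) \<le> 2 * energy (\<lambda>\<xi>. indicator (- {b - W..b + W}) \<xi> * g \<xi>)"
    unfolding u_def by (rule bandlimited_approximation[OF h(1) g])
  also have "\<dots> \<le> 2 * ennreal (1 / 32)" by (intro mult_left_mono freq) simp
  also have "\<dots> = ennreal (2 * (1 / 32))" by (subst ennreal_mult) auto
  finally have ehu: "energy (\<lambda>t. h t - u t) \<le> ennreal (1 / 16)" by simp
  have huL: "(\<lambda>t. h t - u t) \<in> L2"
    using le_less_trans[OF ehu] by (auto simp: L2_iff_energy)
  define c where "c j = w (- T + real j * \<delta>)" for j
  define P where "P t = (\<Sum>j<J. c j * cell T \<delta> j k t)" for t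
  let ?\<kappa> = "(?L * \<delta>)\<^sup>2"
  let ?D = "{- T..<T}"
  \<comment> \<open>On \<open>[-T, T)\<close>: \<open>2 Re (P cnj h) \<ge> |h|\<^sup>2 - |h - P|\<^sup>2\<close>, and \<open>h - P\<close> is split at \<open>u\<close>. Off it, \<open>P\<close> vanishes.\<close>
  have pointwise: "(cmod (h t))\<^sup>2 - (cmod (indicator (- ?D) t * h t))\<^sup>2 - 2 * (cmod (h t - u t))\<^sup>2 - 2 * ?\<kappa> * indicator ?D t
      \<le> 2 * Re (P t * cnj (h t))" for t
  proof (cases "t \<in> ?D")
    case True
    then have t: "- T \<le> t" "t < - T + real J * \<delta>" by (auto simp: \<delta>)
    obtain j where j: "j < J" "- T + real j * \<delta> \<le> t" "t < - T + real (Suc j) * \<delta>"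
      and "(\<Sum>i<J. c i * cell T \<delta> i k t) = c j * cis (2 * pi * k * t)"
      by (rule cell_sum[OF \<open>\<delta> > 0\<close> t])
    then have P: "P t = c j * cis (2 * pi * k * t)" by (simp only: P_def)
    have "u t - P t = (w t - c j) * cis (2 * pi * k * t)"
      by (simp add: u_eq P left_diff_distrib)
    then have "cmod (u t - P t) = cmod (w t - c j)" by (simp add: norm_mult)
    also have "\<dots> \<le> ?L * \<bar>t - (- T + real j * \<delta>)\<bar>" unfolding c_def by (rule w_Lip)
    also have "\<dots> \<le> ?L * \<delta>"
      using j W by (intro mult_left_mono) (auto simp: algebra_simps)
    finally have "(cmod (u t - P t))\<^sup>2 \<le> ?\<kappa>" by (intro power_mono) auto
    moreover have "(cmod (h t - P t))\<^sup>2 \<le> 2 * (cmod (h t - u t))\<^sup>2 + 2 * (cmod (u t - P t))\<^sup>2"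
      using norm_add_squared_le[of "h t - u t" "u t - P t"] by simp
    moreover have "(cmod (h t))\<^sup>2 - (cmod (h t - P t))\<^sup>2 \<le> 2 * Re (P t * cnj (h t))"
      by (rule real_part_mult_cnj_ge)
    ultimately have "(cmod (h t))\<^sup>2 - 2 * (cmod (h t - u t))\<^sup>2 - 2 * ?\<kappa> \<le> 2 * Re (P t * cnj (h t))"
      by linarith
    then show ?thesis using True by simp
  next
    case False
    have "cell T \<delta> j k t = 0" if "j < J" for j
    proof -
      have "real (Suc j) * \<delta> \<le> real J * \<delta>" "0 \<le> real j * \<delta>"
        using that \<open>\<delta> > 0\<close> by (auto intro!: mult_right_mono)
      then show ?thesis using False \<delta> by (auto simp: cell_def indicator_def)
    qed
    then have "P t = 0" by (simp add: P_def)
    then show ?thesis using False by simp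
  qed
  have inner_i: "integrable lborel (\<lambda>t. cell T \<delta> j k t * cnj (h t))" for j
    using \<open>\<delta> > 0\<close> by (intro L2_mult_integrable cell_L2 L2_cnj h) simp
  have Ph: "P t * cnj (h t) = (\<Sum>j<J. c j * (cell T \<delta> j k t * cnj (h t)))" for t
    by (simp add: P_def sum_distrib_right mult.assoc)
  have Phi: "integrable lborel (\<lambda>t. P t * cnj (h t))"
    unfolding Ph by (intro Bochner_Integration.integrable_sum integrable_mult_right inner_i)
  have tL: "(\<lambda>t. indicator (- ?D) t * h t) \<in> L2" by (rule L2_restrict[OF h(1)]) simp
  have i1: "integrable lborel (\<lambda>t. (cmod (h t))\<^sup>2)" and i2: "integrable lborel (\<lambda>t. (cmod (indicator (- ?D) t * h t))\<^sup>2)"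
    and i3: "integrable lborel (\<lambda>t. (cmod (h t - u t))\<^sup>2)"
    using h(1) tL huL unfolding L2_def by auto
  have i4: "integrable lborel (indicator ?D :: real \<Rightarrow> real)" and I4: "(LINT t|lborel. indicator ?D t) = 2 * T"
    using T by auto
  \<comment> \<open>The three errors are 1/16 (time tail), 1/8 (frequency tail) and at most 1/8 (step size), so more than half of the energy is left.\<close>
  have "1 - 1 / 16 - 2 * (1 / 16) - 2 * ?\<kappa> * (2 * T) \<le>
      (LINT t|lborel. (cmod (h t))\<^sup>2) - (LINT t|lborel. (cmod (indicator (- ?D) t * h t))\<^sup>2) - 2 * (LINT t|lborel. (cmod (h t - u t))\<^sup>2) - 2 * ?\<kappa> * (LINT t|lborel. indicator ?D t)"
    using L2_integral_le[OF tL time] L2_integral_le[OF huL ehu] h(2) I4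
    unfolding L2_norm_def by (simp del: integral_indicator)
  also have "\<dots> = (LINT t|lborel. (cmod (h t))\<^sup>2 - (cmod (indicator (- ?D) t * h t))\<^sup>2 - 2 * (cmod (h t - u t))\<^sup>2 - 2 * ?\<kappa> * indicator ?D t)"
    using i1 i2 i3 i4 by simp
  also have "\<dots> \<le> (LINT t|lborel. 2 * Re (P t * cnj (h t)))"
  proof (rule integral_mono[OF _ _ pointwise])
    show "integrable lborel (\<lambda>t. 2 * Re (P t * cnj (h t)))"
      by (intro integrable_mult_right integrable_Re Phi)
  qed (use i1 i2 i3 i4 in auto)
  also have "\<dots> = 2 * Re (LINT t|lborel. P t * cnj (h t))"
    by (simp only: integral_mult_right_zero integral_Re[OF Phi])
  finally have "1 / 4 \<le> Re (LINT t|lborel. P t * cnj (h t))"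
    using fine by (simp add: algebra_simps)
  also have "\<dots> \<le> cmod (LINT t|lborel. P t * cnj (h t))" by (rule complex_Re_le_cmod)
  also have "(LINT t|lborel. P t * cnj (h t)) = (\<Sum>j<J. c j * L2_inner (cell T \<delta> j k) h)"
    unfolding Ph L2_inner_def by (subst Bochner_Integration.integral_sum) (auto intro: inner_i)
  also have "cmod \<dots> \<le> (\<Sum>j<J. cmod (c j) * cmod (L2_inner (cell T \<delta> j k) h))"
    by (rule order_trans[OF norm_sum]) (simp add: norm_mult)
  also have "\<dots> < (\<Sum>j<J. 2 * sqrt W * (1 / (8 * real J * sqrt W)))"
  proof (rule sum_strict_mono)
    fix j assume "j \<in> {..<J}"
    have "cmod (c j) * cmod (L2_inner (cell T \<delta> j k) h) \<le> 2 * sqrt W * cmod (L2_inner (cell T \<delta> j k) h)"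
      unfolding c_def by (intro mult_right_mono w_le) simp
    also have "\<dots> < 2 * sqrt W * (1 / (8 * real J * sqrt W))"
      using small[of j] \<open>j \<in> {..<J}\<close> W by (intro mult_strict_left_mono) auto
    finally show "cmod (c j) * cmod (L2_inner (cell T \<delta> j k) h) < 2 * sqrt W * (1 / (8 * real J * sqrt W))" .
  qed (use J in auto)
  also have "\<dots> = 1 / 4" using J W by simp
  finally show False by simp
qed

section \<open>Summing over frequency centres of bounded density\<close>

text \<open>
  Each element of \<open>F\<close> contributes at least \<open>\<eta>\<^sup>s\<close> to a series that is bounded by \<open>(N / B)\<^sup>s\<close>.
\<close>

lemma frame_upper_count:
  assumes "B > 0" "s > 0" "\<eta> > 0" "N \<ge> 0"
    and bound: "ennreal B * lp_size s c \<le> ennreal N"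
    and F: "finite F" "\<And>n. n \<in> F \<Longrightarrow> \<eta> \<le> cmod (c n)"
  shows "real (card F) * \<eta> powr s \<le> (N / B) powr s"
proof -
  define X where "X = (\<Sum>n. ennreal (cmod (c n) powr s))"
  have "(\<Sum>n\<in>F. ennreal (cmod (c n) powr s)) \<le> X"
    unfolding X_def by (intro sum_le_suminf F) auto
  then have sumF: "ennreal (\<Sum>n\<in>F. cmod (c n) powr s) \<le> X"
    by (simp add: sum_ennreal)
  have "X \<noteq> \<infinity>"
  proof
    assume "X = \<infinity>"
    then have "ennreal B * \<infinity> \<le> ennreal N"
      using bound by (simp add: lp_size_def ennpowr_def X_def)
    then show False using \<open>B > 0\<close> by (simp add: ennreal_mult_top top_unique)
  qed
  then obtain x where x: "X = ennreal x" "x \<ge> 0" by (cases X) auto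
  have "lp_size s c = ennreal (x powr (1 / s))"
    using x by (simp add: lp_size_def ennpowr_def flip: X_def)
  then have "B * x powr (1 / s) \<le> N"
    using bound \<open>B > 0\<close> \<open>N \<ge> 0\<close> by (simp add: ennreal_mult[symmetric])
  then have "x powr (1 / s) \<le> N / B" using \<open>B > 0\<close> by (simp add: field_simps)
  then have "(x powr (1 / s)) powr s \<le> (N / B) powr s"
    using \<open>s > 0\<close> by (intro powr_mono2) auto
  then have x_le: "x \<le> (N / B) powr s" using \<open>s > 0\<close> x by (simp add: powr_powr)
  have "real (card F) * \<eta> powr s = (\<Sum>n\<in>F. \<eta> powr s)" by simp
  also have "\<dots> \<le> (\<Sum>n\<in>F. cmod (c n) powr s)"
    using assms by (intro sum_mono powr_mono2 F) auto
  also have "\<dots> \<le> x" using sumF x by simp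
  finally show ?thesis using x_le by simp
qed

text \<open>
  If every interval of length 2 contains at most \<open>M\<close> of the points, then at most \<open>2 M\<close> of them satisfy
  \<open>m \<le> |b n| < m + 1\<close>, one batch on each side of the origin, so the series is dominated by
  a multiple of the zeta series.
\<close>

lemma summable_of_bounded_occupancy:
  fixes b :: "nat \<Rightarrow> real"
  assumes occ: "\<And>k F. finite F \<Longrightarrow> (\<And>n. n \<in> F \<Longrightarrow> \<bar>b n - k\<bar> \<le> 1) \<Longrightarrow> real (card F) \<le> M"
    and "\<alpha> > 1"
  shows "summable (\<lambda>n. (1 + \<bar>b n\<bar>) powr (- \<alpha>))"
proof (rule summableI_nonneg_bounded)
  let ?d = "\<lambda>m::nat. real (Suc m) powr (- \<alpha>)"
  have "summable (\<lambda>m::nat. real m powr (- \<alpha>))"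
    using \<open>\<alpha> > 1\<close> by (simp add: summable_real_powr_iff)
  then have d: "summable ?d" by (subst summable_Suc_iff)
  have "M \<ge> 0" using occ[of "{}" 0] by simp
  fix n
  have "\<exists>m::nat. real m \<le> \<bar>b i\<bar> \<and> \<bar>b i\<bar> < real m + 1" for i
    by (intro exI[of _ "nat \<lfloor>\<bar>b i\<bar>\<rfloor>"]) simp
  then obtain \<nu> :: "nat \<Rightarrow> nat" where m: "\<And>i. real (\<nu> i) \<le> \<bar>b i\<bar>" "\<And>i. \<bar>b i\<bar> < real (\<nu> i) + 1"
    by metis
  have "(\<Sum>i<n. (1 + \<bar>b i\<bar>) powr (- \<alpha>)) \<le> (\<Sum>i<n. ?d (\<nu> i))"
  proof (rule sum_mono)
    fix i
    have "real (Suc (\<nu> i)) \<le> 1 + \<bar>b i\<bar>"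
      using m(1)[of i] unfolding of_nat_Suc by (rule add_left_mono)
    then show "(1 + \<bar>b i\<bar>) powr (- \<alpha>) \<le> ?d (\<nu> i)"
      using \<open>\<alpha> > 1\<close> by (intro powr_mono2') auto
  qed
  also have "\<dots> = (\<Sum>m\<in>\<nu> ` {..<n}. \<Sum>i\<in>{i\<in>{..<n}. \<nu> i = m}. ?d (\<nu> i))"
    by (rule sum.image_gen) simp
  also have "\<dots> \<le> (\<Sum>m\<in>\<nu> ` {..<n}. 2 * M * ?d m)"
  proof (rule sum_mono)
    fix m
    let ?S = "{i\<in>{..<n}. \<nu> i = m}"
    let ?P = "{i\<in>?S. b i \<ge> 0}" and ?N = "{i\<in>?S. b i < 0}"
    have P: "real (card ?P) \<le> M"
    proof (rule occ)
      fix i assume "i \<in> ?P"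
      then show "\<bar>b i - real m\<bar> \<le> 1" using m[of i] by auto
    qed simp
    have N: "real (card ?N) \<le> M"
    proof (rule occ)
      fix i assume "i \<in> ?N"
      then show "\<bar>b i - (- real m)\<bar> \<le> 1" using m[of i] by auto
    qed simp
    have "card ?S = card (?P \<union> ?N)" by (rule arg_cong[where f = card]) auto
    also have "\<dots> \<le> card ?P + card ?N" by (rule card_Un_le)
    finally have "real (card ?S) \<le> 2 * M" using P N by linarith
    then have "real (card ?S) * ?d m \<le> 2 * M * ?d m" by (intro mult_right_mono) auto
    then show "(\<Sum>i\<in>?S. ?d (\<nu> i)) \<le> 2 * M * ?d m" by simp
  qed
  also have "\<dots> = 2 * M * (\<Sum>m\<in>\<nu> ` {..<n}. ?d m)" by (rule sum_distrib_left[symmetric])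
  also have "\<dots> \<le> 2 * M * (\<Sum>m. ?d m)"
    using \<open>M \<ge> 0\<close> by (intro mult_left_mono sum_le_suminf d) auto
  finally show "(\<Sum>i<n. (1 + \<bar>b i\<bar>) powr (- \<alpha>)) \<le> 2 * M * (\<Sum>m. ?d m)" .
qed simp

section \<open>Translated Gaussians\<close>

lemma gauss_mult_powr_le:
  assumes "q > 0"
  shows "gauss x * (1 + \<bar>x\<bar>) powr q \<le> exp (q\<^sup>2 / (4 * pi))"
proof -
  have "(1 + \<bar>x\<bar>) powr q \<le> (exp \<bar>x\<bar>) powr q"
    using assms exp_ge_add_one_self[of "\<bar>x\<bar>"] by (intro powr_mono2) auto
  also have "\<dots> = exp (q * \<bar>x\<bar>)" by (simp add: powr_def)
  finally have "gauss x * (1 + \<bar>x\<bar>) powr q \<le> gauss x * exp (q * \<bar>x\<bar>)"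
    by (intro mult_left_mono) auto
  also have "\<dots> = exp (q * \<bar>x\<bar> - pi * \<bar>x\<bar>\<^sup>2)" by (simp add: gauss_def mult_exp_exp)
  also have "\<dots> \<le> exp (q\<^sup>2 / (4 * pi))"
  proof -
    have "q\<^sup>2 / (4 * pi) - (q * \<bar>x\<bar> - pi * \<bar>x\<bar>\<^sup>2) = pi * (\<bar>x\<bar> - q / (2 * pi))\<^sup>2"
      by (simp add: power2_eq_square field_simps)
    then have "0 \<le> q\<^sup>2 / (4 * pi) - (q * \<bar>x\<bar> - pi * \<bar>x\<bar>\<^sup>2)"
      by (simp only:) simp
    then show ?thesis by (simp only: diff_ge_0_iff_ge exp_le_cancel_iff)
  qed
  finally show ?thesis .
qed

lemma gauss_weight_L2:
  assumes "q > 0"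
  shows "(\<lambda>x. complex_of_real (gauss x * (1 + \<bar>x\<bar>) powr (q / 2))) \<in> L2"
proof -
  have "integrable lborel (\<lambda>x. (cmod (complex_of_real (gauss x * (1 + \<bar>x\<bar>) powr (q / 2))))\<^sup>2)"
  proof (rule Bochner_Integration.integrable_bound)
    show "integrable lborel (\<lambda>x. gauss x * exp (q\<^sup>2 / (4 * pi)))" using gauss_integrable by simp
    show "AE x in lborel. norm ((cmod (complex_of_real (gauss x * (1 + \<bar>x\<bar>) powr (q / 2))))\<^sup>2) \<le> norm (gauss x * exp (q\<^sup>2 / (4 * pi)))"
    proof (intro AE_I2)
      fix x
      have "(cmod (complex_of_real (gauss x * (1 + \<bar>x\<bar>) powr (q / 2))))\<^sup>2 = gauss x * (gauss x * (1 + \<bar>x\<bar>) powr q)"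
        by (simp add: norm_mult power_mult_distrib power2_eq_square powr_add[symmetric] mult_ac)
      also have "\<dots> \<le> gauss x * exp (q\<^sup>2 / (4 * pi))"
        by (intro mult_left_mono gauss_mult_powr_le assms) simp
      finally show "norm ((cmod (complex_of_real (gauss x * (1 + \<bar>x\<bar>) powr (q / 2))))\<^sup>2) \<le> norm (gauss x * exp (q\<^sup>2 / (4 * pi)))"
        by (simp add: abs_mult)
    qed
  qed measurable
  then show ?thesis by (simp add: L2_def)
qed

lemma ennreal_power2_le_imp_le:
  assumes "(x::ennreal)\<^sup>2 \<le> ennreal c" and "c \<ge> 0"
  shows "x \<le> ennreal (sqrt c)"
proof (cases x)
  case (real r)
  then have "ennreal (r\<^sup>2) \<le> ennreal c" using assms by (simp add: ennreal_power)
  then have "r \<le> sqrt c"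
    using \<open>c \<ge> 0\<close> by (auto intro: real_le_rsqrt)
  then show ?thesis using real by (simp add: ennreal_leI)
next
  case top
  then show ?thesis using assms by (simp add: top_unique power2_eq_square)
qed

text \<open>
  The weight \<open>1 + |x|\<close> is submultiplicative: \<open>1 + |b| \<le> (1 + |\<xi>|) (1 + |\<xi> - b|)\<close>. Raising this to
  the power \<open>q / 2\<close> and applying Cauchy-Schwarz, the first factor is absorbed by the Gaussian and the second
  by the energy of \<open>g\<close> and its \<open>q\<close>-th moment about \<open>b\<close>. This is where the exponent \<open>q / 2\<close> comes from.
\<close>

lemma gauss_pairing_decay:
  assumes "q > 0" "D \<ge> 0"
  obtains c where "c \<ge> 0" "\<And>g b. g \<in> L2 \<Longrightarrow> energy g \<le> ennreal 2 \<Longrightarrow> moment q g b \<le> ennreal D \<Longrightarrow>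
    (\<integral>\<^sup>+\<xi>. ennreal (gauss \<xi> * cmod (g \<xi>)) \<partial>lborel) \<le> ennreal (c * (1 + \<bar>b\<bar>) powr (- (q / 2)))"
proof -
  define F where "F x = complex_of_real (gauss x * (1 + \<bar>x\<bar>) powr (q / 2))" for x
  have F: "F \<in> L2" unfolding F_def using \<open>q > 0\<close> by (rule gauss_weight_L2)
  define K where "K = (L2_norm F)\<^sup>2"
  have K: "energy F = ennreal K" "K \<ge> 0" unfolding K_def using energy_eq_L2_norm[OF F] by auto
  define c where "c = sqrt (K * (2 powr q * (2 + D)))"
  have "c \<ge> 0" unfolding c_def using K assms by simp
  moreover have "(\<integral>\<^sup>+\<xi>. ennreal (gauss \<xi> * cmod (g \<xi>)) \<partial>lborel) \<le> ennreal (c * (1 + \<bar>b\<bar>) powr (- (q / 2)))"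
    if g: "g \<in> L2" and e: "energy g \<le> ennreal 2" and mom: "moment q g b \<le> ennreal D" for g b
  proof -
    have [measurable]: "g \<in> borel_measurable borel" using g by (simp add: L2_def)
    define G where "G x = complex_of_real ((1 + \<bar>x - b\<bar>) powr (q / 2)) * g x" for x
    have [measurable]: "G \<in> borel_measurable borel" unfolding G_def by measurable
    have "energy G \<le> (\<integral>\<^sup>+x. ennreal (2 powr q) * (ennreal ((cmod (g x))\<^sup>2) + ennreal (\<bar>x - b\<bar> powr q * (cmod (g x))\<^sup>2)) \<partial>lborel)"
      unfolding energy_def
    proof (intro nn_integral_mono)
      fix x
      have "(cmod (G x))\<^sup>2 = (1 + \<bar>x - b\<bar>) powr q * (cmod (g x))\<^sup>2"
        by (simp add: G_def norm_mult power_mult_distrib power2_eq_square powr_add[symmetric])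
      also have "\<dots> \<le> 2 powr q * (1 + \<bar>x - b\<bar> powr q) * (cmod (g x))\<^sup>2"
        using abs_add_powr_le[OF \<open>q > 0\<close>, of 1 "\<bar>x - b\<bar>"] by (intro mult_right_mono) auto
      finally have "ennreal ((cmod (G x))\<^sup>2) \<le> ennreal (2 powr q * ((cmod (g x))\<^sup>2 + \<bar>x - b\<bar> powr q * (cmod (g x))\<^sup>2))"
        by (intro ennreal_leI) (simp add: algebra_simps)
      then show "ennreal ((cmod (G x))\<^sup>2) \<le> ennreal (2 powr q) * (ennreal ((cmod (g x))\<^sup>2) + ennreal (\<bar>x - b\<bar> powr q * (cmod (g x))\<^sup>2))"
        by (simp add: ennreal_mult ennreal_plus)
    qed
    also have "\<dots> = ennreal (2 powr q) * (energy g + moment q g b)"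
      unfolding energy_def moment_def by (simp add: nn_integral_cmult nn_integral_add)
    also have "\<dots> \<le> ennreal (2 powr q) * (ennreal 2 + ennreal D)"
      by (intro mult_left_mono add_mono e mom) auto
    also have "\<dots> = ennreal (2 powr q * (2 + D))" using assms by (simp add: ennreal_mult ennreal_plus)
    finally have eG: "energy G \<le> ennreal (2 powr q * (2 + D))" .
    then have G: "G \<in> L2" by (auto simp: L2_iff_energy intro: le_less_trans)
    have "ennreal ((1 + \<bar>b\<bar>) powr (q / 2)) * (\<integral>\<^sup>+\<xi>. ennreal (gauss \<xi> * cmod (g \<xi>)) \<partial>lborel)
        = (\<integral>\<^sup>+\<xi>. ennreal ((1 + \<bar>b\<bar>) powr (q / 2)) * ennreal (gauss \<xi> * cmod (g \<xi>)) \<partial>lborel)"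
      by (rule nn_integral_cmult[symmetric]) measurable
    also have "\<dots> \<le> (\<integral>\<^sup>+\<xi>. ennreal (cmod (F \<xi>) * cmod (G \<xi>)) \<partial>lborel)"
    proof (intro nn_integral_mono)
      fix \<xi>
      have "1 + \<bar>b\<bar> \<le> (1 + \<bar>\<xi>\<bar>) * (1 + \<bar>\<xi> - b\<bar>)"
      proof -
        have "1 + \<bar>b\<bar> \<le> 1 + \<bar>\<xi>\<bar> + \<bar>\<xi> - b\<bar>" by linarith
        also have "\<dots> \<le> 1 + \<bar>\<xi>\<bar> + \<bar>\<xi> - b\<bar> + \<bar>\<xi>\<bar> * \<bar>\<xi> - b\<bar>" by simp
        finally show ?thesis by (simp add: algebra_simps)
      qed
      then have "(1 + \<bar>b\<bar>) powr (q / 2) \<le> ((1 + \<bar>\<xi>\<bar>) * (1 + \<bar>\<xi> - b\<bar>)) powr (q / 2)"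
        using \<open>q > 0\<close> by (intro powr_mono2) auto
      also have "\<dots> = (1 + \<bar>\<xi>\<bar>) powr (q / 2) * (1 + \<bar>\<xi> - b\<bar>) powr (q / 2)"
        by (simp add: powr_mult)
      finally have "(1 + \<bar>b\<bar>) powr (q / 2) * (gauss \<xi> * cmod (g \<xi>)) \<le> (1 + \<bar>\<xi>\<bar>) powr (q / 2) * (1 + \<bar>\<xi> - b\<bar>) powr (q / 2) * (gauss \<xi> * cmod (g \<xi>))"
        by (intro mult_right_mono) auto
      also have "\<dots> = cmod (F \<xi>) * cmod (G \<xi>)"
        by (simp add: F_def G_def norm_mult)
      finally show "ennreal ((1 + \<bar>b\<bar>) powr (q / 2)) * ennreal (gauss \<xi> * cmod (g \<xi>)) \<le> ennreal (cmod (F \<xi>) * cmod (G \<xi>))"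
        by (simp add: ennreal_mult[symmetric] ennreal_leI)
    qed
    also have "\<dots> \<le> ennreal c"
      unfolding c_def
    proof (rule ennreal_power2_le_imp_le)
      have "(\<integral>\<^sup>+\<xi>. ennreal (cmod (F \<xi>) * cmod (G \<xi>)) \<partial>lborel)\<^sup>2 \<le> energy F * energy G"
        by (rule nn_integral_Cauchy_Schwarz[OF F G])
      also have "\<dots> \<le> ennreal K * ennreal (2 powr q * (2 + D))"
        using eG by (simp add: K mult_left_mono)
      also have "\<dots> = ennreal (K * (2 powr q * (2 + D)))" using K assms by (simp add: ennreal_mult)
      finally show "(\<integral>\<^sup>+\<xi>. ennreal (cmod (F \<xi>) * cmod (G \<xi>)) \<partial>lborel)\<^sup>2 \<le> ennreal (K * (2 powr q * (2 + D)))" .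
    qed (use K assms in simp)
    finally have "ennreal ((1 + \<bar>b\<bar>) powr (- (q / 2))) * (ennreal ((1 + \<bar>b\<bar>) powr (q / 2)) * (\<integral>\<^sup>+\<xi>. ennreal (gauss \<xi> * cmod (g \<xi>)) \<partial>lborel))
        \<le> ennreal ((1 + \<bar>b\<bar>) powr (- (q / 2))) * ennreal c"
      by (intro mult_left_mono) auto
    moreover have "(1 + \<bar>b\<bar>) powr (- (q / 2)) * (1 + \<bar>b\<bar>) powr (q / 2) = 1"
      by (simp add: powr_add[symmetric])
    ultimately show ?thesis
      using \<open>c \<ge> 0\<close> by (simp add: mult.assoc[symmetric] ennreal_mult[symmetric]) (simp add: mult.commute)
  qed
  ultimately show ?thesis by (rule that)
qed

text \<open>
  The test functions: Gaussians escaping to infinity in time, whose transforms all have the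
  same modulus.
\<close>

definition bump :: "real \<Rightarrow> real \<Rightarrow> complex" where
  "bump R t = complex_of_real (gauss (t - R))"

lemma bump_measurable [measurable]: "bump R \<in> borel_measurable borel"
  unfolding bump_def[abs_def] by measurable

lemma gauss_shift_integrable: "integrable lborel (\<lambda>t. gauss (t - R))"
  using gauss_scaled_integrable[of 1 "- R"] by (simp add: add.commute)

lemma gauss_shift_integral: "(LINT t|lborel. gauss (t - R)) = 1"
  using lborel_integral_real_affine[of 1 gauss "- R"] gauss_integral by (simp add: add.commute)

lemma bump_L2: "bump R \<in> L2"
proof -
  have "integrable lborel (\<lambda>t. (cmod (bump R t))\<^sup>2)"
  proof (rule Bochner_Integration.integrable_bound[OF gauss_shift_integrable[of R]])
    show "AE t in lborel. norm ((cmod (bump R t))\<^sup>2) \<le> norm (gauss (t - R))"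
      by (intro AE_I2) (auto simp: bump_def power2_eq_square gauss_le_1 intro!: mult_left_le)
  qed measurable
  then show ?thesis by (simp add: L2_def)
qed

lemma L2_norm_bump: "L2_norm (bump R) = L2_norm (bump 0)"
  using lborel_integral_real_affine[of 1 "\<lambda>t. (cmod (bump R t))\<^sup>2" R]
  by (simp add: L2_norm_def bump_def)

lemma L2_norm_bump_pos: "L2_norm (bump R) > 0"
proof -
  have i: "integrable lborel (\<lambda>t. (cmod (bump R t))\<^sup>2)" using bump_L2[of R] by (simp add: L2_def)
  have "(LINT t|lborel. (cmod (bump R t))\<^sup>2) \<noteq> 0"
  proof
    assume "(LINT t|lborel. (cmod (bump R t))\<^sup>2) = 0"
    then have "AE t in lborel. (cmod (bump R t))\<^sup>2 = 0"
      using integral_nonneg_eq_0_iff_AE[OF i] by simp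
    then have "AE t in (lborel :: real measure). False"
      by eventually_elim (simp add: bump_def less_imp_neq[OF gauss_pos, symmetric])
    then show False by (simp add: trivial_limit_def[symmetric] ae_filter_eq_bot_iff)
  qed
  moreover have "(LINT t|lborel. (cmod (bump R t))\<^sup>2) \<ge> 0" by simp
  ultimately show ?thesis by (simp add: L2_norm_def less_le)
qed

lemma fourier_integral_modulated_gauss:
  "fourier_integral (\<lambda>\<xi>. complex_of_real (gauss \<xi>) * cis (2 * pi * \<xi> * R)) = bump R"
  using fourier_integral_gauss_scaled[of 1 "- R"]
  by (auto simp: fun_eq_iff bump_def gauss_kernel_def)

lemma bump_pairing_fourier:
  assumes h: "h \<in> L2" and g: "is_L2_fourier h g"
  shows "(LINT t|lborel. h t * bump R t) = (LINT \<xi>|lborel. g \<xi> * (complex_of_real (gauss \<xi>) * cis (2 * pi * \<xi> * R)))"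
proof (rule LIMSEQ_unique)
  let ?\<psi> = "\<lambda>\<xi>. complex_of_real (gauss \<xi>) * cis (2 * pi * \<xi> * R)"
  have \<psi>i: "integrable lborel ?\<psi>"
    using gauss_integrable by (intro integrable_mult_cis) auto
  have "energy ?\<psi> = energy (bump 0)"
    by (rule energy_cong_cmod) (simp add: bump_def norm_mult)
  then have \<psi>L: "?\<psi> \<in> L2" using bump_L2[of 0] by (auto simp: L2_iff_energy)
  show "(\<lambda>N. LINT t|lborel. cutoff N h t * bump R t) \<longlonglongrightarrow> (LINT t|lborel. h t * bump R t)"
    by (intro L2_pairing_tendsto cutoff_L2 h bump_L2 cutoff_tail_tendsto_0)
  have "(\<lambda>N. LINT \<xi>|lborel. fourier_integral (cutoff N h) \<xi> * ?\<psi> \<xi>) \<longlonglongrightarrow> (LINT \<xi>|lborel. g \<xi> * ?\<psi> \<xi>)"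
    using g by (intro L2_pairing_tendsto fourier_integral_L2 cutoff_integrable cutoff_L2 h \<psi>L)
      (auto simp: is_L2_fourier_iff)
  then show "(\<lambda>N. LINT t|lborel. cutoff N h t * bump R t) \<longlonglongrightarrow> (LINT \<xi>|lborel. g \<xi> * ?\<psi> \<xi>)"
    by (simp only: fourier_multiplication_formula[OF cutoff_integrable[OF h] \<psi>i] fourier_integral_modulated_gauss)
qed

lemma norm_inner_bump: "cmod (L2_inner (bump R) h) = cmod (LINT t|lborel. h t * bump R t)"
proof -
  have "L2_inner (bump R) h = (LINT t|lborel. cnj (h t * bump R t))"
    unfolding L2_inner_def by (intro Bochner_Integration.integral_cong refl) (simp add: bump_def mult.commute)
  also have "\<dots> = cnj (LINT t|lborel. h t * bump R t)"
    by (rule Bochner_Integration.integral_cnj)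
  finally show ?thesis by simp
qed

text \<open>
  On the frequency side a translation is a modulation, so the bound does not depend on \<open>R\<close>.
\<close>

lemma inner_bump_le:
  assumes "h \<in> L2" and "is_L2_fourier h g"
  shows "ennreal (cmod (L2_inner (bump R) h)) \<le> (\<integral>\<^sup>+\<xi>. ennreal (gauss \<xi> * cmod (g \<xi>)) \<partial>lborel)"
  unfolding norm_inner_bump bump_pairing_fourier[OF assms]
  by (rule order_trans[OF norm_integral_le_nn_integral]) (simp add: norm_mult mult.commute)

text \<open>
  The Gaussian is split into two square roots. One of them has energy 1; the other one is attached
  to \<open>h\<close> and makes its energy tend to 0 by dominated convergence.
\<close>

lemma inner_bump_tendsto_0:
  assumes h: "h \<in> L2"
  shows "(\<lambda>n. cmod (L2_inner (bump (real n)) h)) \<longlonglongrightarrow> 0"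
proof -
  have [measurable]: "h \<in> borel_measurable borel" using h by (simp add: L2_def)
  let ?r = "\<lambda>n t. complex_of_real (sqrt (gauss (t - real n)))"
  have er: "energy (?r n) = 1" for n
    unfolding energy_def using nn_integral_eq_integral[OF gauss_shift_integrable[of "real n"]]
    by (simp add: gauss_shift_integral)
  have rL: "?r n \<in> L2" for n by (simp add: L2_iff_energy er)
  have rhL: "(\<lambda>t. ?r n t * h t) \<in> L2" for n
    by (rule L2_bounded_mult[OF h]) (auto simp: gauss_le_1)
  have sq: "ennreal ((cmod (L2_inner (bump (real n)) h))\<^sup>2) \<le> energy (\<lambda>t. ?r n t * h t)" for n
  proof -
    have "(LINT t|lborel. h t * bump (real n) t) = (LINT t|lborel. ?r n t * (?r n t * h t))"
      by (intro Bochner_Integration.integral_cong refl)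
         (simp add: bump_def mult.assoc[symmetric] flip: of_real_mult)
    then show ?thesis
      unfolding norm_inner_bump using Cauchy_Schwarz_energy[OF rL rhL, of n n] by (simp add: er)
  qed
  have "(\<lambda>n. energy (\<lambda>t. ?r n t * h t)) \<longlonglongrightarrow> (\<integral>\<^sup>+t. 0 \<partial>(lborel :: real measure))"
    unfolding energy_def
  proof (rule nn_integral_dominated_convergence)
    show "AE t in lborel. (\<lambda>n. ennreal ((cmod (?r n t * h t))\<^sup>2)) \<longlonglongrightarrow> 0"
    proof (intro AE_I2)
      fix t
      have "(\<lambda>n. gauss (t - real n)) \<longlonglongrightarrow> 0" unfolding gauss_def by real_asymp
      then have "(\<lambda>n. gauss (t - real n) * (cmod (h t))\<^sup>2) \<longlonglongrightarrow> 0 * (cmod (h t))\<^sup>2"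
        by (intro tendsto_mult tendsto_const)
      then have "(\<lambda>n. ennreal (gauss (t - real n) * (cmod (h t))\<^sup>2)) \<longlonglongrightarrow> ennreal 0"
        by (intro tendsto_ennrealI) simp
      then show "(\<lambda>n. ennreal ((cmod (?r n t * h t))\<^sup>2)) \<longlonglongrightarrow> 0"
        by (simp add: norm_mult power_mult_distrib)
    qed
    show "AE t in lborel. ennreal ((cmod (?r n t * h t))\<^sup>2) \<le> ennreal ((cmod (h t))\<^sup>2)" for n
      by (intro AE_I2) (auto simp: norm_mult power_mult_distrib gauss_le_1 intro!: mult_left_le_one_le ennreal_leI)
    show "(\<integral>\<^sup>+t. ennreal ((cmod (h t))\<^sup>2) \<partial>lborel) < \<infinity>"
      using h by (auto simp: L2_iff_energy energy_def)
  qed auto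
  then have lim: "(\<lambda>n. energy (\<lambda>t. ?r n t * h t)) \<longlonglongrightarrow> 0" by simp
  have "(\<lambda>n. ennreal ((cmod (L2_inner (bump (real n)) h))\<^sup>2)) \<longlonglongrightarrow> 0"
    by (rule tendsto_sandwich[OF _ _ tendsto_const lim]) (use sq in auto)
  then have "(\<lambda>n. (cmod (L2_inner (bump (real n)) h))\<^sup>2) \<longlonglongrightarrow> 0"
    by (subst (asm) ennreal_0[symmetric], subst (asm) tendsto_ennreal_iff) auto
  then show ?thesis
    using tendsto_real_sqrt[of "\<lambda>n. (cmod (L2_inner (bump (real n)) h))\<^sup>2" 0] by simp
qed

section \<open>Impossibility of uniform localization\<close>

text \<open>
  The functions whose frequency centre lies within 1 of \<open>k\<close> are all detected by one of \<open>J\<close> cells,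
  and the threshold, \<open>J\<close> and the norms of the cells do not depend on \<open>k\<close>. Since the coefficients of a
  single cell have bounded \<open>s\<close>-sum, it can detect only boundedly many functions.
\<close>

lemma bounded_occupancy:
  fixes e g :: "nat \<Rightarrow> real \<Rightarrow> complex" and a b :: "nat \<Rightarrow> real"
  assumes "A > 0" "B > 0" "p > 0" "q > 0" "s > 0"
    and e: "\<And>n. e n \<in> L2" "\<And>n. L2_norm (e n) = 1"
    and g: "\<And>n. is_L2_fourier (e n) (g n)"
    and frame: "\<And>f. f \<in> L2 \<Longrightarrow> ennreal B * lp_size s (\<lambda>n. L2_inner f (e n)) \<le> ennreal (L2_norm f)"
    and centre: "\<And>n. \<bar>a n\<bar> \<le> A"
    and time: "\<And>n. moment p (e n) (a n) \<le> ennreal (A\<^sup>2)"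
    and freq: "\<And>n. moment q (g n) (b n) \<le> ennreal (A'\<^sup>2)" and "A' > 0"
  shows "\<exists>M. \<forall>k F. finite F \<longrightarrow> (\<forall>n\<in>F. \<bar>b n - k\<bar> \<le> 1) \<longrightarrow> real (card F) \<le> M"
proof -
  have [measurable]: "e n \<in> borel_measurable borel" "g n \<in> borel_measurable borel" for n
    using e(1)[of n] g[of n] by (auto simp: is_L2_fourier_iff L2_def)
  \<comment> \<open>The window sizes for which the Chebyshev tails equal the tolerances of the detection lemma.\<close>
  define W where "W = (32 * A'\<^sup>2) powr (1 / q)"
  have W: "W > 0" "A'\<^sup>2 / W powr q = 1 / 32"
    using assms by (auto simp: W_def powr_powr)
  define V where "V = (16 * A\<^sup>2) powr (1 / p)"
  have V: "V > 0" "A\<^sup>2 / V powr p = 1 / 16"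
    using assms by (auto simp: V_def powr_powr)
  \<comment> \<open>The summand 1 makes the half-open \<open>[-T, T)\<close> contain every closed interval \<open>[a n - V, a n + V]\<close>.\<close>
  define T where "T = A + V + 1"
  have "T > 0" using V \<open>A > 0\<close> by (simp add: T_def)
  let ?L = "4 * pi * (W + 1) * sqrt W"
  obtain J0 :: nat where J0: "32 * T * (?L * (2 * T))\<^sup>2 \<le> real J0" using real_arch_simple by blast
  define J where "J = Suc J0"
  define \<delta> where "\<delta> = 2 * T / real J"
  have J: "J > 0" "real J * \<delta> = 2 * T" "\<delta> \<ge> 0" using \<open>T > 0\<close> by (auto simp: J_def \<delta>_def)
  have fine: "32 * T * (?L * \<delta>)\<^sup>2 \<le> 1"
  proof -
    have "32 * T * (?L * \<delta>)\<^sup>2 = 32 * T * (?L * (2 * T))\<^sup>2 / (real J)\<^sup>2"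
      by (simp add: \<delta>_def power_divide power_mult_distrib)
    also have "\<dots> \<le> real J / (real J)\<^sup>2"
      using J0 by (intro divide_right_mono) (auto simp: J_def)
    also have "\<dots> \<le> 1" using J by (simp add: power2_eq_square J_def)
    finally show ?thesis .
  qed
  define \<eta> where "\<eta> = 1 / (8 * real J * sqrt W)"
  have "\<eta> > 0" using J W by (simp add: \<eta>_def)
  have detect: "\<exists>j<J. \<eta> \<le> cmod (L2_inner (cell T \<delta> j k) (e n))" if k: "\<bar>b n - k\<bar> \<le> 1" for n k
    unfolding \<eta>_def
  proof (rule cell_detection[OF e g W(1) k _ _ \<open>T > 0\<close> J(1,2) fine])
    show "energy (\<lambda>\<xi>. indicator (- {b n - W..b n + W}) \<xi> * g n \<xi>) \<le> ennreal (1 / 32)"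
      using energy_tail_le[OF _ freq W(1) \<open>q > 0\<close>, of n] W by simp
    have "energy (\<lambda>t. indicator (- {- T..<T}) t * e n t) \<le> energy (\<lambda>t. indicator (- {a n - V..a n + V}) t * e n t)"
      using centre[of n] by (intro energy_mono) (auto simp: T_def indicator_def abs_le_iff)
    also have "\<dots> \<le> ennreal (1 / 16)"
      using energy_tail_le[OF _ time V(1) \<open>p > 0\<close>, of n] V by simp
    finally show "energy (\<lambda>t. indicator (- {- T..<T}) t * e n t) \<le> ennreal (1 / 16)" .
  qed
  define M where "M = (sqrt \<delta> / B) powr s / \<eta> powr s"
  have "real (card F) \<le> real J * M" if F: "finite F" "\<And>n. n \<in> F \<Longrightarrow> \<bar>b n - k\<bar> \<le> 1" for k F
  proof -
    let ?F = "\<lambda>j. {n \<in> F. \<eta> \<le> cmod (L2_inner (cell T \<delta> j k) (e n))}"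
    have "F \<subseteq> (\<Union>j\<in>{..<J}. ?F j)" using detect[OF F(2)] by fastforce
    then have "card F \<le> card (\<Union>j\<in>{..<J}. ?F j)"
      using F(1) by (intro card_mono) auto
    also have "\<dots> \<le> (\<Sum>j<J. card (?F j))" by (rule card_UN_le) simp
    finally have "real (card F) \<le> (\<Sum>j<J. real (card (?F j)))" by (simp flip: of_nat_sum)
    also have "\<dots> \<le> (\<Sum>j<J. M)"
    proof (rule sum_mono)
      fix j
      have upper: "ennreal B * lp_size s (\<lambda>n. L2_inner (cell T \<delta> j k) (e n)) \<le> ennreal (sqrt \<delta>)"
        using frame[OF cell_L2[OF J(3)], of T j k] by (simp add: L2_norm_cell[OF J(3)])
      have "real (card (?F j)) * \<eta> powr s \<le> (sqrt \<delta> / B) powr s"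
        by (rule frame_upper_count[OF \<open>B > 0\<close> \<open>s > 0\<close> \<open>\<eta> > 0\<close> _ upper]) (use F J in auto)
      then show "real (card (?F j)) \<le> M"
        using \<open>\<eta> > 0\<close> by (simp add: M_def pos_le_divide_eq)
    qed
    finally show ?thesis by simp
  qed
  then show ?thesis by blast
qed

lemma lp_size_eq:
  assumes "summable (\<lambda>n. cmod (c n) powr r)"
  shows "lp_size r c = ennreal ((\<Sum>n. cmod (c n) powr r) powr (1 / r))"
proof -
  have "(\<Sum>n. ennreal (cmod (c n) powr r)) = ennreal (\<Sum>n. cmod (c n) powr r)"
    by (rule suminf_ennreal2) (use assms in auto)
  moreover have "(\<Sum>n. cmod (c n) powr r) \<ge> 0" by (intro suminf_nonneg assms) auto
  ultimately show ?thesis by (simp add: lp_size_def ennpowr_def)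
qed

theorem theorem4p2:
  fixes A B C p q r s :: real and e :: "nat \<Rightarrow> real \<Rightarrow> complex"
  assumes "A > 0" and "B > 0" and "C > 0"
    and "p > 1" and "q > 1" and "r > 0" and "s > 0"
    and "\<And>n. e n \<in> L2" and "\<And>n. L2_norm (e n) = 1"
    and "\<And>f. f \<in> L2 \<Longrightarrow>
           ennreal B * lp_size s (\<lambda>n. L2_inner f (e n)) \<le> ennreal (L2_norm f) \<and>
           ennreal (L2_norm f) \<le> ennreal C * lp_size r (\<lambda>n. L2_inner f (e n))"
    and "q * r > 2"
  shows "\<not> (\<forall>n. dispersion p (e n) < \<infinity> \<and> \<bar>p_mean p (e n)\<bar> \<le> A \<and>
                dispersion p (e n) \<le> ennreal A \<and>
                dispersion q (L2_fourier (e n)) \<le> ennreal A)"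
proof
  assume loc: "\<forall>n. dispersion p (e n) < \<infinity> \<and> \<bar>p_mean p (e n)\<bar> \<le> A \<and>
                dispersion p (e n) \<le> ennreal A \<and>
                dispersion q (L2_fourier (e n)) \<le> ennreal A"
  note e = \<open>\<And>n. e n \<in> L2\<close> \<open>\<And>n. L2_norm (e n) = 1\<close>
  define g where "g n = L2_fourier (e n)" for n
  have g: "is_L2_fourier (e n) (g n)" for n
    unfolding g_def by (rule is_L2_fourier_L2_fourier[OF e(1)])
  then have gL: "g n \<in> L2" for n by (simp add: is_L2_fourier_iff)
  have eg: "energy (g n) \<le> ennreal 2" for n
    using energy_fourier_le[OF e(1) g, of n] by (simp add: energy_eq_L2_norm[OF e(1)] e(2))
  have time: "moment p (e n) (p_mean p (e n)) \<le> ennreal (A\<^sup>2)" for n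
    using loc spread_p_mean[OF e \<open>p > 1\<close>, of n] \<open>A > 0\<close> by (intro spread_le_imp_moment_le) auto
  \<comment> \<open>The frequency centres only have to be near-minimizers, at the cost of replacing \<open>A\<close> by \<open>A + 1\<close>.\<close>
  have "\<exists>b. moment q (g n) b \<le> ennreal ((A + 1)\<^sup>2)" for n
  proof -
    have "dispersion q (g n) \<le> ennreal A" using loc by (simp add: g_def)
    also have "\<dots> < ennreal (A + 1)" using \<open>A > 0\<close> by (simp add: ennreal_lessI)
    finally obtain b where "spread q (g n) b < ennreal (A + 1)"
      by (auto simp: dispersion_def INF_less_iff)
    then show ?thesis using \<open>A > 0\<close> by (intro exI[of _ b] spread_le_imp_moment_le) auto
  qed
  then obtain b where freq: "\<And>n. moment q (g n) (b n) \<le> ennreal ((A + 1)\<^sup>2)" by metis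
  obtain M where "\<forall>k F. finite F \<longrightarrow> (\<forall>n\<in>F. \<bar>b n - k\<bar> \<le> 1) \<longrightarrow> real (card F) \<le> M"
    using bounded_occupancy[of A B p q s e g "\<lambda>n. p_mean p (e n)" b "A + 1"] assms g loc time freq by auto
  then have M: "\<And>k F. finite F \<Longrightarrow> (\<And>n. n \<in> F \<Longrightarrow> \<bar>b n - k\<bar> \<le> 1) \<Longrightarrow> real (card F) \<le> M"
    by blast
  \<comment> \<open>The decay exponent exceeds 1, the threshold for points of bounded density, exactly when \<open>q * r > 2\<close>.\<close>
  have sum: "summable (\<lambda>n. (1 + \<bar>b n\<bar>) powr (- (q * r / 2)))"
    by (rule summable_of_bounded_occupancy[OF M]) (use \<open>q * r > 2\<close> in auto)
  obtain c where "c \<ge> 0" and decay: "\<And>g b. g \<in> L2 \<Longrightarrow> energy g \<le> ennreal 2 \<Longrightarrow> moment q g b \<le> ennreal ((A + 1)\<^sup>2) \<Longrightarrow>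
      (\<integral>\<^sup>+\<xi>. ennreal (gauss \<xi> * cmod (g \<xi>)) \<partial>lborel) \<le> ennreal (c * (1 + \<bar>b\<bar>) powr (- (q / 2)))"
    by (rule gauss_pairing_decay[of q "(A + 1)\<^sup>2"]) (use \<open>q > 1\<close> in auto)
  have c: "(\<integral>\<^sup>+\<xi>. ennreal (gauss \<xi> * cmod (g n \<xi>)) \<partial>lborel) \<le> ennreal (c * (1 + \<bar>b n\<bar>) powr (- (q / 2)))" for n
    by (rule decay[OF gL eg freq])
  \<comment> \<open>The coefficients of the escaping Gaussians are dominated by a summable sequence that does not
  depend on \<open>N\<close>, and each of them tends to 0; so their \<open>r\<close>-sums tend to 0 as well.\<close>
  define x where "x n N = cmod (L2_inner (bump (real N)) (e n)) powr r" for n N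
  have x_le: "x n N \<le> c powr r * (1 + \<bar>b n\<bar>) powr (- (q * r / 2))" for n N
  proof -
    have "ennreal (cmod (L2_inner (bump (real N)) (e n))) \<le> ennreal (c * (1 + \<bar>b n\<bar>) powr (- (q / 2)))"
      using inner_bump_le[OF e(1) g, of "real N" n] c[of n] by (rule order_trans)
    then have "cmod (L2_inner (bump (real N)) (e n)) \<le> c * (1 + \<bar>b n\<bar>) powr (- (q / 2))"
      using \<open>c \<ge> 0\<close> by simp
    then have "x n N \<le> (c * (1 + \<bar>b n\<bar>) powr (- (q / 2))) powr r"
      unfolding x_def using \<open>r > 0\<close> by (intro powr_mono2) auto
    also have "\<dots> = c powr r * (1 + \<bar>b n\<bar>) powr (- (q * r / 2))"
      by (simp add: powr_mult powr_powr)
    finally show ?thesis .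
  qed
  have x_nonneg: "x n N \<ge> 0" for n N by (simp add: x_def)
  have sum': "summable (\<lambda>n. c powr r * (1 + \<bar>b n\<bar>) powr (- (q * r / 2)))"
    by (rule summable_mult[OF sum])
  have x_sum: "summable (\<lambda>n. x n N)" for N
    by (rule summable_comparison_test_ev[OF _ sum']) (simp add: x_le x_nonneg)
  have x_lim: "(\<lambda>N. x n N) \<longlonglongrightarrow> 0" for n
    unfolding x_def using tendsto_powr'[OF inner_bump_tendsto_0[OF e(1), of n] tendsto_const, of r] \<open>r > 0\<close> by simp
  have dom: "eventually (\<lambda>(n, N). norm (x n N) \<le> c powr r * (1 + \<bar>b n\<bar>) powr (- (q * r / 2))) (at_top \<times>\<^sub>F sequentially)"
    by (intro always_eventually) (auto simp: x_le x_nonneg)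
  have "(\<lambda>N. \<Sum>n. x n N) \<longlonglongrightarrow> (\<Sum>n. 0)"
    using tannerys_theorem[OF x_lim dom sum'] by simp
  then have "(\<lambda>N. (\<Sum>n. x n N) powr (1 / r)) \<longlonglongrightarrow> 0 powr (1 / r)"
    using \<open>r > 0\<close> by (intro tendsto_powr' tendsto_const) (auto simp: x_nonneg x_sum suminf_nonneg)
  then have lim: "(\<lambda>N. C * (\<Sum>n. x n N) powr (1 / r)) \<longlonglongrightarrow> C * 0"
    by (intro tendsto_mult tendsto_const) simp
  have "L2_norm (bump 0) \<le> C * (\<Sum>n. x n N) powr (1 / r)" for N
  proof -
    have "ennreal (L2_norm (bump (real N))) \<le> ennreal C * lp_size r (\<lambda>n. L2_inner (bump (real N)) (e n))"
      using assms(10)[OF bump_L2] by blast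
    also have "lp_size r (\<lambda>n. L2_inner (bump (real N)) (e n)) = ennreal ((\<Sum>n. x n N) powr (1 / r))"
      unfolding x_def by (rule lp_size_eq) (use x_sum[of N] in \<open>simp add: x_def\<close>)
    finally show ?thesis
      using \<open>C > 0\<close> by (simp add: L2_norm_bump[of "real N"] ennreal_mult[symmetric])
  qed
  then have "L2_norm (bump 0) \<le> C * 0"
    by (intro LIMSEQ_le_const[OF lim]) auto
  then show False using L2_norm_bump_pos[of 0] by simp
qed

end
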